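(* Let $X_{2\omega}=\bigsqcup_{i=1}^\infty Y_{\omega+i}$ be the metric space, with metric $d$, constructed explicitly in the context. Then its transfinite asymptotic dimension is $\operatorname{trasdim}(X_{2\omega})=2\omega$.
   Context: $\mathbb{N}$ is the set of positive integers, $\omega$ is the first infinite ordinal, and $2\omega$ denotes the ordinal $\omega+\omega$, the least ordinal greater than all $\omega+k$, $k\in\mathbb{N}$. **Transfinite asymptotic dimension.** A family $\mathcal{A}$ of subsets of a metric space $(X,d)$ is uniformly bounded if there is a number $C>0$ such that $\operatorname{diam} A\le C$ for each $A\in\mathcal{A}$. For $r>0$, the family $\mathcal{A}$ is $r$-disjoint if $d(A_1,A_2)\ge r$ for all $A_1,A_2\in\mathcal{A}$ with $A_1\ne A_2$, where $d(A_1,A_2)=\inf\{d(a_1,a_2) : a_1\in A_1, a_2\in A_2\}$. For a set $L$, let $\operatorname{Fin} L$ be the collection of all finite non-empty subsets of $L$. For $M\subseteq \operatorname{Fin} L$ and $\sigma\in\{\emptyset\}\cup\operatorname{Fin} L$ put $$M^\sigma=\{\tau\in \operatorname{Fin} L \mid \sigma\cup\tau\in M \text{ and } \sigma\cap\tau=\emptyset\},$$ and write $M^a$ for $M^{\{a\}}$ when $a\in L$. The ordinal $\operatorname{Ord} M$ is defined inductively: - $\operatorname{Ord} M=0$ iff $M=\emptyset$; - for an ordinal $\alpha>0$, $\operatorname{Ord} M\le\alpha$ iff $\operatorname{Ord} M^a<\alpha$ for every $a\in L$; - $\operatorname{Ord} M=\alpha$ iff $\operatorname{Ord} M\le\alpha$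 and $\operatorname{Ord} M<\alpha$ is not true; - $\operatorname{Ord} M=\infty$ iff $\operatorname{Ord} M>\alpha$ for every ordinal $\alpha$. For a metric space $(X,d)$, let $A(X,d)$ be the collection of all $\sigma\in\operatorname{Fin}\mathbb{N}$ such that there do not exist uniformly bounded families $\mathcal{V}_i$ ($i\in\sigma$) of subsets of $X$ such that $\bigcup_{i\in\sigma}\mathcal{V}_i$ covers $X$ and each $\mathcal{V}_i$ is $i$-disjoint. Put $\operatorname{trasdim} X=\operatorname{Ord} A(X,d)$ (with $L=\mathbb{N}$). **The spaces $X_{\omega+k}$.** Equip $\mathbb{R}^n$ with the sup-metric $d_\infty((k_1,\dots,k_n),(l_1,\dots,l_n))=\max\{|k_1-l_1|,\dots,|k_n-l_n|\}$. For $k\le n$ let $i_n^k:\mathbb{R}^k\to\mathbb{R}^n$ be the isometric embedding $i_n^k(x_1,\dots,x_k)=(x_1,\dots,x_k,0,\dots,0)$. For $i,k\in\mathbb{N}$ define $$X_k^{(i)}=\{x\in\mathbb{R}^i : |\{l\in\{1,\dots,i\} : x_l\notin 2^i\mathbb{Z}\}|\le k\},\qquad X_{\omega+k}=\bigsqcup_{i=1}^\infty X_k^{(i)}.$$ Define a metric $d_k$ on $X_{\omega+k}$ as follows: for $x\in X_k^{(m)}$ and $y\in X_k^{(n)}$ with $m\le n$, put $c_k=0$ if $n=m$ and $c_k=k(m+(m+1)+\dots+(n-1))$ if $m<n$, and let $$d_k(x,y)=\max\{d_\infty(i_n^m(x),y),c_k\}.$$ For $m\le n$ let $j_n^m:X_{\omega+m}\to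 X_{\omega+n}$ be the natural inclusion, given on each piece by the inclusion $X_m^{(i)}\subset X_n^{(i)}$. **The space $X_{2\omega}$.** For $k,m\in\mathbb{N}$ put $$Y_k^{(m)}=X_k^{(m)}\cap(2^k\mathbb{Z})^m,\qquad Y_{\omega+k}=\bigsqcup_{i=1}^\infty Y_k^{(i)}\subset X_{\omega+k},\qquad X_{2\omega}=\bigsqcup_{i=1}^\infty Y_{\omega+i}.$$ Define a metric $d$ on $X_{2\omega}$ as follows: for $x\in Y_{\omega+m}$ and $y\in Y_{\omega+n}$ with $m\le n$, put $c=0$ if $n=m$ and $c=m+(m+1)+\dots+(n-1)$ if $m<n$, and let $$d(x,y)=\max\{d_n(j_n^m(x),y),c\}.$$ *)

theory Defs
  imports "HOL-Analysis.Analysis"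
begin

section \<open>Countable ordinals\<close>

text \<open>
  An ordinal is the order type of a well-order whose field is a set of natural numbers. These are
  exactly the countable ordinals. They suffice to define the ordinal \<open>Ord\<close> of families of finite
  subsets of a countable set: if it is not infinite, it is a supremum of at most countably many
  successors of ordinals of the same kind, hence countable by induction. So
  ``greater than every countable ordinal'' is the same as ``greater than every ordinal'' there.
\<close>

quotient_type ordinal = "nat rel" / partial: "\<lambda>r s. (r, s) \<in> ordIso"
  by (rule part_equivpI)
     (use natLeq_Well_order ordIso_reflexive in blast,
      auto intro!: sympI transpI intro: ordIso_symmetric ordIso_transitive)

instantiation ordinal :: linorder
begin

lift_definition less_eq_ordinal :: "ordinal \<Rightarrow> ordinal \<Rightarrow> bool" is "\<lambda>r s. (r, s) \<in> ordLeq"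
  by (meson ordIso_ordLeq_trans ordIso_symmetric ordLeq_ordIso_trans)

lift_definition less_ordinal :: "ordinal \<Rightarrow> ordinal \<Rightarrow> bool" is "\<lambda>r s. (r, s) \<in> ordLess"
  by (meson ordIso_ordLess_trans ordIso_symmetric ordLess_ordIso_trans)

instance
proof
  fix x y z :: ordinal
  show "x < y \<longleftrightarrow> x \<le> y \<and> \<not> y \<le> x"
    by transfer (metis not_ordLeq_ordLess ordIso_iff_ordLeq ordLeq_iff_ordLess_or_ordIso)
  show "x \<le> x"
    by transfer (simp add: ordIso_iff_ordLeq)
  show "x \<le> y \<Longrightarrow> y \<le> z \<Longrightarrow> x \<le> z"
    by transfer (rule ordLeq_transitive)
  show "x \<le> y \<Longrightarrow> y \<le> x \<Longrightarrow> x = y"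
    by transfer (simp add: ordIso_iff_ordLeq)
  show "x \<le> y \<or> y \<le> x"
    by transfer (metis ordLeq_Well_order_simp ordIso_iff_ordLeq ordLeq_total)
qed

end

instance ordinal :: wellorder
proof
  fix P :: "ordinal \<Rightarrow> bool" and a :: ordinal
  assume step: "\<And>x. (\<And>y. y < x \<Longrightarrow> P y) \<Longrightarrow> P x"
  have rep: "(rep_ordinal x, rep_ordinal y) \<in> ordLess" if "x < y" for x y
    using that by (simp add: less_ordinal.rep_eq)
  have "wf {(x :: ordinal, y). x < y}"
    by (rule wf_subset[OF wf_inv_image[OF wf_ordLess, of rep_ordinal]])
       (auto simp: inv_image_def rep)
  then show "P a"
    by (rule wf_induct_rule) (auto intro: step)
qed

text \<open>
  The sum of two ordinals is the order type of a copy of the first well-order on the even numbers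
  followed by a copy of the second one on the odd numbers.
\<close>

definition nat_osum :: "nat rel \<Rightarrow> nat rel \<Rightarrow> nat rel" where
  "nat_osum r s =
     {(2 * x, 2 * y) | x y. (x, y) \<in> r}
   \<union> {(2 * x + 1, 2 * y + 1) | x y. (x, y) \<in> s}
   \<union> {(2 * x, 2 * y + 1) | x y. x \<in> Field r \<and> y \<in> Field s}"

lemma even_odd_simps: "2 * (x::nat) \<noteq> Suc (2 * y)" "Suc (2 * y) \<noteq> 2 * x"
  by presburger+

lemma nat_osum_simps [simp]:
  "(2 * x, 2 * y) \<in> nat_osum r s \<longleftrightarrow> (x, y) \<in> r"
  "(Suc (2 * x), Suc (2 * y)) \<in> nat_osum r s \<longleftrightarrow> (x, y) \<in> s"
  "(2 * x, Suc (2 * y)) \<in> nat_osum r s \<longleftrightarrow> x \<in> Field r \<and> y \<in> Field s"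
  "(Suc (2 * x), 2 * y) \<notin> nat_osum r s"
  by (auto simp: nat_osum_def even_odd_simps)

lemma nat_parity_cases:
  fixes n :: nat
  obtains x where "n = 2 * x" | x where "n = Suc (2 * x)"
  by (metis oddE evenE Suc_eq_plus1)

lemma Field_nat_osum: "Field (nat_osum r s) = (\<lambda>x. 2 * x) ` Field r \<union> (\<lambda>x. Suc (2 * x)) ` Field s"
proof -
  have "n \<in> Field (nat_osum r s) \<longleftrightarrow>
      n \<in> (\<lambda>x. 2 * x) ` Field r \<union> (\<lambda>x. Suc (2 * x)) ` Field s" for n
    by (cases n rule: nat_parity_cases)
       (fastforce simp: nat_osum_def Field_def Domain_iff Range_iff even_odd_simps)+
  then show ?thesis by blast
qed

lemma in_Field_nat_osum [simp]:
  "2 * x \<in> Field (nat_osum r s) \<longleftrightarrow> x \<in> Field r"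
  "Suc (2 * x) \<in> Field (nat_osum r s) \<longleftrightarrow> x \<in> Field s"
  by (auto simp: Field_nat_osum even_odd_simps)

lemma Well_order_nat_osum:
  assumes "Well_order r" "Well_order s"
  shows "Well_order (nat_osum r s)"
proof -
  let ?t = "nat_osum r s"
  have r: "Refl r" "trans r" "antisym r" "Total r" "wf (r - Id)"
   and s: "Refl s" "trans s" "antisym s" "Total s" "wf (s - Id)"
    using assms by (auto simp: order_on_defs)
  have r4: "(a, b) \<in> r \<or> (b, a) \<in> r" if "a \<in> Field r" "b \<in> Field r" "a \<noteq> b" for a b
    using r(4) that by (auto simp: total_on_def)
  have s4: "(a, b) \<in> s \<or> (b, a) \<in> s" if "a \<in> Field s" "b \<in> Field s" "a \<noteq> b" for a b
    using s(4) that by (auto simp: total_on_def)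
  have refl: "Refl ?t"
    using r(1) s(1) by (auto simp: refl_on_def Field_nat_osum)
  have trans: "trans ?t"
  proof (rule transI)
    fix a b c assume "(a, b) \<in> ?t" "(b, c) \<in> ?t"
    then show "(a, c) \<in> ?t"
      by (cases a rule: nat_parity_cases; cases b rule: nat_parity_cases;
          cases c rule: nat_parity_cases)
         (auto intro: transD[OF r(2)] transD[OF s(2)] FieldI1 FieldI2)
  qed
  have antisym: "antisym ?t"
  proof (rule antisymI)
    fix a b assume "(a, b) \<in> ?t" "(b, a) \<in> ?t"
    then show "a = b"
      by (cases a rule: nat_parity_cases; cases b rule: nat_parity_cases)
         (auto dest: antisymD[OF r(3)] antisymD[OF s(3)])
  qed
  have total: "Total ?t"
  proof (rule total_onI)
    fix a b assume "a \<in> Field ?t" "b \<in> Field ?t" "a \<noteq> b"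
    then show "(a, b) \<in> ?t \<or> (b, a) \<in> ?t"
      by (cases a rule: nat_parity_cases; cases b rule: nat_parity_cases)
         (auto dest: r4 s4)
  qed
  have "wf (?t - Id)"
  proof (rule wfI_min)
    fix x :: nat and Q assume "x \<in> Q"
    show "\<exists>z\<in>Q. \<forall>y. (y, z) \<in> ?t - Id \<longrightarrow> y \<notin> Q"
    proof (cases "\<exists>e. 2 * e \<in> Q")
      case True
      then obtain e where "e \<in> {e. 2 * e \<in> Q}" by blast
      then have "\<exists>z\<in>{e. 2 * e \<in> Q}. \<forall>y. (y, z) \<in> r - Id \<longrightarrow> y \<notin> {e. 2 * e \<in> Q}"
        by (rule r(5)[unfolded wf_eq_minimal, rule_format])
      then obtain z where z: "2 * z \<in> Q" "\<And>y. (y, z) \<in> r \<Longrightarrow> y \<noteq> z \<Longrightarrow> 2 * y \<notin> Q"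
        by auto
      have "y \<notin> Q" if "(y, 2 * z) \<in> ?t - Id" for y
        using that z(2) by (cases y rule: nat_parity_cases) auto
      then show ?thesis using z(1) by auto
    next
      case False
      then obtain e where "e \<in> {e. Suc (2 * e) \<in> Q}"
        using \<open>x \<in> Q\<close> by (cases x rule: nat_parity_cases) auto
      then have "\<exists>z\<in>{e. Suc (2 * e) \<in> Q}. \<forall>y. (y, z) \<in> s - Id \<longrightarrow> y \<notin> {e. Suc (2 * e) \<in> Q}"
        by (rule s(5)[unfolded wf_eq_minimal, rule_format])
      then obtain z where z: "Suc (2 * z) \<in> Q" "\<And>y. (y, z) \<in> s \<Longrightarrow> y \<noteq> z \<Longrightarrow> Suc (2 * y) \<notin> Q"
        by auto
      have "y \<notin> Q" if "(y, Suc (2 * z)) \<in> ?t - Id" for y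
        using that z(2) False by (cases y rule: nat_parity_cases) auto
      then show ?thesis using z(1) by auto
    qed
  qed
  with refl trans antisym total show ?thesis
    by (auto simp: order_on_defs intro: FieldI1 FieldI2)
qed

lemma nat_osum_cong:
  assumes "(r, r') \<in> ordIso" "(s, s') \<in> ordIso"
  shows "(nat_osum r s, nat_osum r' s') \<in> ordIso"
proof -
  obtain f g where wo: "Well_order r" "Well_order r'" "Well_order s" "Well_order s'"
    and iso: "iso r r' f" "iso s s' g"
    using assms unfolding ordIso_def by blast
  have f: "bij_betw f (Field r) (Field r')"
      "\<forall>a\<in>Field r. \<forall>b\<in>Field r. (a, b) \<in> r \<longleftrightarrow> (f a, f b) \<in> r'"
    using iso(1) unfolding iso_iff2 by blast+
  have g: "bij_betw g (Field s) (Field s')"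
      "\<forall>a\<in>Field s. \<forall>b\<in>Field s. (a, b) \<in> s \<longleftrightarrow> (g a, g b) \<in> s'"
    using iso(2) unfolding iso_iff2 by blast+
  define h where "h n = (if even n then 2 * f (n div 2) else Suc (2 * g (n div 2)))" for n :: nat
  have h [simp]: "h (2 * x) = 2 * f x" "h (Suc (2 * x)) = Suc (2 * g x)" for x
    by (simp_all add: h_def)
  have inj: "inj_on h (Field (nat_osum r s))"
  proof (rule inj_onI)
    fix a b assume "a \<in> Field (nat_osum r s)" "b \<in> Field (nat_osum r s)" "h a = h b"
    then show "a = b"
      by (cases a rule: nat_parity_cases; cases b rule: nat_parity_cases)
         (simp_all add: even_odd_simps bij_betw_imp_inj_on[OF f(1), THEN inj_on_eq_iff]
           bij_betw_imp_inj_on[OF g(1), THEN inj_on_eq_iff])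
  qed
  have fs: "f ` Field r = Field r'" "g ` Field s = Field s'"
    using f(1) g(1) by (auto simp: bij_betw_def)
  have surj: "h ` Field (nat_osum r s) = Field (nat_osum r' s')"
    by (simp add: Field_nat_osum image_Un image_image fs[symmetric])
  have f': "f a \<in> Field r'" if "a \<in> Field r" for a using that fs by blast
  have g': "g a \<in> Field s'" if "a \<in> Field s" for a using that fs by blast
  have "(a, b) \<in> nat_osum r s \<longleftrightarrow> (h a, h b) \<in> nat_osum r' s'"
    if "a \<in> Field (nat_osum r s)" "b \<in> Field (nat_osum r s)" for a b
    using that
    by (cases a rule: nat_parity_cases; cases b rule: nat_parity_cases) (simp_all add: f(2) g(2) f' g')
  then have "iso (nat_osum r s) (nat_osum r' s') h"
    unfolding iso_iff2 bij_betw_def using inj surj by blast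
  then show ?thesis
    using Well_order_nat_osum wo unfolding ordIso_def by blast
qed

instantiation ordinal :: "{zero, plus}"
begin

lift_definition zero_ordinal :: ordinal is "{}"
  by (simp add: ordIso_reflexive order_on_defs refl_on_def trans_def antisym_def total_on_def)

lift_definition plus_ordinal :: "ordinal \<Rightarrow> ordinal \<Rightarrow> ordinal" is nat_osum
  by (rule nat_osum_cong)

instance ..

end

lift_definition omega :: ordinal is natLeq
  by (simp add: ordIso_reflexive natLeq_Well_order)


definition two_omega :: ordinal where
  "two_omega = omega + omega"

lift_definition ordinal_of_nat :: "nat \<Rightarrow> ordinal" is "\<lambda>n. Restr natLeq {..<n}"
  by (simp add: ordIso_reflexive Well_order_Restr natLeq_Well_order)

text \<open>
  \<open>ordinal_of_nat\<close> is only needed to check that \<open>\<omega> + \<omega>\<close> is the least ordinal above all \<open>\<omega> + k\<close>.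
\<close>

lemma Restr_nat_osum_underS:
  "Restr (nat_osum natLeq natLeq) (underS (nat_osum natLeq natLeq) (Suc (2 * k))) =
     nat_osum natLeq (Restr natLeq {..<k})" (is "?R = ?S")
proof -
  have F: "Field (Restr natLeq {..<k}) = {..<k}"
    by (auto simp: Field_def natLeq_def)
  have N: "(x, y) \<in> natLeq \<longleftrightarrow> x \<le> y" for x y
    by (simp add: natLeq_def)
  have "p \<in> ?R \<longleftrightarrow> p \<in> ?S" for p
    by (cases p; cases "fst p" rule: nat_parity_cases; cases "snd p" rule: nat_parity_cases)
       (auto simp: underS_def F N Field_natLeq even_odd_simps)
  then show ?thesis by blast
qed

lemma two_omega_Least: "two_omega = (LEAST \<beta>. \<forall>k. omega + ordinal_of_nat k < \<beta>)"
proof -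
  let ?T = "nat_osum natLeq natLeq"
  have T: "Well_order ?T"
    using Well_order_nat_osum natLeq_Well_order by blast
  have "Field ?T \<noteq> {}"
    by (simp add: Field_nat_osum Field_natLeq)
  note * = underS_Restr_ordLess[OF T this]
  have below: "omega + ordinal_of_nat k < two_omega" for k
    unfolding two_omega_def
    by transfer (simp only: Restr_nat_osum_underS[symmetric] *)
  have least: "\<exists>k. \<beta> \<le> omega + ordinal_of_nat k" if "\<beta> < two_omega" for \<beta>
    using that unfolding two_omega_def
  proof transfer
    fix t :: "nat rel"
    assume "(t, ?T) \<in> ordLess" and "(t, t) \<in> ordIso"
    then obtain a where a: "(t, Restr ?T (underS ?T a)) \<in> ordIso"
      using ordLess_iff_ordIso_Restr[OF T] unfolding ordLess_def by blast
    obtain k where "underS ?T a \<subseteq> underS ?T (Suc (2 * k))"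
    proof (cases a rule: nat_parity_cases)
      case (1 x)
      have "underS ?T (2 * x) \<subseteq> underS ?T (Suc (2 * x))"
      proof
        fix b assume "b \<in> underS ?T (2 * x)"
        then show "b \<in> underS ?T (Suc (2 * x))"
          by (cases b rule: nat_parity_cases)
             (auto simp: underS_def Field_natLeq even_odd_simps)
      qed
      with 1 show ?thesis by (intro that[of x]) simp
    next
      case (2 x)
      then show ?thesis by (intro that[of x]) simp
    qed
    then have "(Restr ?T (underS ?T a), Restr ?T (underS ?T (Suc (2 * k)))) \<in> ordLeq"
      using ofilter_subset_ordLeq[OF T] wo_rel.underS_ofilter[of ?T] T
      by (simp add: wo_rel_def)
    with a show "\<exists>k. (t, nat_osum natLeq (Restr natLeq {..<k})) \<in> ordLeq"
      unfolding Restr_nat_osum_underS by (blast intro: ordIso_ordLeq_trans)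
  qed
  show ?thesis
  proof (rule sym, rule Least_equality)
    show "\<forall>k. omega + ordinal_of_nat k < two_omega" using below by blast
    show "two_omega \<le> \<beta>" if "\<forall>k. omega + ordinal_of_nat k < \<beta>" for \<beta>
      using that least[of \<beta>] by (meson not_less)
  qed
qed

lemma zero_le_ordinal: "(0 :: ordinal) \<le> \<alpha>"
proof transfer
  fix r :: "nat rel" assume "(r, r) \<in> ordIso"
  then have r: "Well_order r"
    by (simp add: ordIso_def)
  then have "wo_rel r" "wo_rel.ofilter r {}"
    by (simp_all add: wo_rel_def wo_rel.ofilter_def)
  with ofilter_subset_ordLeq[OF r this(2) wo_rel.Field_ofilter[OF this(1)]]
  show "({} :: nat rel, r) \<in> ordLeq" by (simp add: Restr_Field)
qed

lemma not_less_zero_ordinal [simp]: "\<not> \<alpha> < (0 :: ordinal)"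
  by (simp add: not_less zero_le_ordinal)

section \<open>The ordinal of a family of finite sets\<close>

definition Fin :: "'a set \<Rightarrow> 'a set set" where
  "Fin L = {\<sigma>. finite \<sigma> \<and> \<sigma> \<noteq> {} \<and> \<sigma> \<subseteq> L}"

definition link :: "'a set \<Rightarrow> 'a set set \<Rightarrow> 'a set \<Rightarrow> 'a set set" where
  "link L M \<sigma> = {\<tau> \<in> Fin L. \<sigma> \<union> \<tau> \<in> M \<and> \<sigma> \<inter> \<tau> = {}}"

text \<open>
  \<open>Ord_le L M \<alpha>\<close> and \<open>Ord_less L M \<alpha>\<close> are the relations \<open>Ord M \<le> \<alpha>\<close> and \<open>Ord M < \<alpha>\<close>.
\<close>

inductive Ord_le :: "nat set \<Rightarrow> nat set set \<Rightarrow> ordinal \<Rightarrow> bool" for L where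
  Ord_le_zero: "Ord_le L {} 0"
| Ord_le_pos: "0 < \<alpha> \<Longrightarrow> (\<And>a. a \<in> L \<Longrightarrow> \<exists>\<beta><\<alpha>. Ord_le L (link L M {a}) \<beta>) \<Longrightarrow> Ord_le L M \<alpha>"

definition Ord_less :: "nat set \<Rightarrow> nat set set \<Rightarrow> ordinal \<Rightarrow> bool" where
  "Ord_less L M \<alpha> \<longleftrightarrow> (\<exists>\<beta><\<alpha>. Ord_le L M \<beta>)"

datatype ext_ordinal = Ordinal ordinal | Infinite

definition Ord :: "nat set \<Rightarrow> nat set set \<Rightarrow> ext_ordinal" where
  "Ord L M = (if \<exists>\<alpha>. Ord_le L M \<alpha> then Ordinal (LEAST \<alpha>. Ord_le L M \<alpha>) else Infinite)"

lemma Ord_le_0_iff: "Ord_le L M 0 \<longleftrightarrow> M = {}"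
  by (auto elim: Ord_le.cases intro: Ord_le_zero)

lemma Ord_le_pos_iff:
  "0 < \<alpha> \<Longrightarrow> Ord_le L M \<alpha> \<longleftrightarrow> (\<forall>a\<in>L. Ord_less L (link L M {a}) \<alpha>)"
  unfolding Ord_less_def by (auto elim: Ord_le.cases intro: Ord_le_pos)

lemma Ord_eq_Ordinal_iff: "Ord L M = Ordinal \<alpha> \<longleftrightarrow> Ord_le L M \<alpha> \<and> \<not> Ord_less L M \<alpha>"
proof
  assume "Ord L M = Ordinal \<alpha>"
  then show "Ord_le L M \<alpha> \<and> \<not> Ord_less L M \<alpha>"
    by (auto simp: Ord_def Ord_less_def split: if_splits intro: LeastI dest: not_less_Least)
next
  assume *: "Ord_le L M \<alpha> \<and> \<not> Ord_less L M \<alpha>"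
  then have "(LEAST \<alpha>. Ord_le L M \<alpha>) = \<alpha>"
    by (intro Least_equality) (auto simp: Ord_less_def not_less[symmetric])
  with * show "Ord L M = Ordinal \<alpha>"
    by (auto simp: Ord_def)
qed

lemma Ord_eq_0_iff: "Ord L M = Ordinal 0 \<longleftrightarrow> M = {}"
  by (auto simp: Ord_eq_Ordinal_iff Ord_le_0_iff Ord_less_def)

section \<open>Transfinite asymptotic dimension\<close>

text \<open>
  The notions below are stated for a set \<open>X\<close> with an arbitrary distance function \<open>d\<close>: their
  definitions do not involve the axioms of a metric.
\<close>

definition diam :: "('a \<Rightarrow> 'a \<Rightarrow> real) \<Rightarrow> 'a set \<Rightarrow> ereal" where
  "diam d A = (SUP x\<in>A. SUP y\<in>A. ereal (d x y))"

definition dist_sets :: "('a \<Rightarrow> 'a \<Rightarrow> real) \<Rightarrow> 'a set \<Rightarrow> 'a set \<Rightarrow> ereal" where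
  "dist_sets d A B = (INF x\<in>A. INF y\<in>B. ereal (d x y))"

definition uniformly_bounded :: "('a \<Rightarrow> 'a \<Rightarrow> real) \<Rightarrow> 'a set set \<Rightarrow> bool" where
  "uniformly_bounded d \<A> \<longleftrightarrow> (\<exists>C>0. \<forall>A\<in>\<A>. diam d A \<le> ereal C)"

definition r_disjoint :: "('a \<Rightarrow> 'a \<Rightarrow> real) \<Rightarrow> real \<Rightarrow> 'a set set \<Rightarrow> bool" where
  "r_disjoint d r \<A> \<longleftrightarrow> (\<forall>A\<in>\<A>. \<forall>B\<in>\<A>. A \<noteq> B \<longrightarrow> dist_sets d A B \<ge> ereal r)"

definition A_family :: "'a set \<Rightarrow> ('a \<Rightarrow> 'a \<Rightarrow> real) \<Rightarrow> nat set set" where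
  "A_family X d = {\<sigma> \<in> Fin {1..}.
     \<not> (\<exists>\<V>. (\<forall>i\<in>\<sigma>. \<V> i \<subseteq> Pow X \<and> uniformly_bounded d (\<V> i) \<and> r_disjoint d (real i) (\<V> i)) \<and>
             X \<subseteq> \<Union> (\<Union>i\<in>\<sigma>. \<V> i))}"

definition trasdim :: "'a set \<Rightarrow> ('a \<Rightarrow> 'a \<Rightarrow> real) \<Rightarrow> ext_ordinal" where
  "trasdim X d = Ord {1..} (A_family X d)"

section \<open>The space of transfinite asymptotic dimension \<open>2\<omega>\<close>\<close>

text \<open>
  A point of \<open>\<real>\<^sup>n\<close> is a real sequence that vanishes outside the indices \<open>1, \<dots>, n\<close>. Hence the
  embedding of \<open>\<real>\<^sup>k\<close> into \<open>\<real>\<^sup>n\<close> that appends zeros is a set inclusion and does not appear in the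
  formulas.
\<close>

definition euclid :: "nat \<Rightarrow> (nat \<Rightarrow> real) set" where
  "euclid n = {x. \<forall>l. l \<notin> {1..n} \<longrightarrow> x l = 0}"

definition d_sup :: "nat \<Rightarrow> (nat \<Rightarrow> real) \<Rightarrow> (nat \<Rightarrow> real) \<Rightarrow> real" where
  "d_sup n x y = (MAX l\<in>{1..n}. \<bar>x l - y l\<bar>)"

definition pow2_multiples :: "nat \<Rightarrow> real set" where
  "pow2_multiples i = range (\<lambda>z::int. 2 ^ i * real_of_int z)"

definition X_piece :: "nat \<Rightarrow> nat \<Rightarrow> (nat \<Rightarrow> real) set" where
  "X_piece k i = {x \<in> euclid i. card {l \<in> {1..i}. x l \<notin> pow2_multiples i} \<le> k}"

definition X_omega :: "nat \<Rightarrow> (nat \<times> (nat \<Rightarrow> real)) set" where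
  "X_omega k = (SIGMA i:{1..}. X_piece k i)"

text \<open>
  The formulas for \<open>d_omega\<close> and \<open>d_2omega\<close> are symmetric in the two points; for equal indices the
  sum is empty.
\<close>

definition d_omega :: "nat \<Rightarrow> nat \<times> (nat \<Rightarrow> real) \<Rightarrow> nat \<times> (nat \<Rightarrow> real) \<Rightarrow> real" where
  "d_omega k = (\<lambda>(m, x) (n, y).
     max (d_sup (max m n) x y) (real (k * (\<Sum>i = min m n..<max m n. i))))"

definition Y_piece :: "nat \<Rightarrow> nat \<Rightarrow> (nat \<Rightarrow> real) set" where
  "Y_piece k m = X_piece k m \<inter> {x. \<forall>l\<in>{1..m}. x l \<in> pow2_multiples k}"

definition Y_omega :: "nat \<Rightarrow> (nat \<times> (nat \<Rightarrow> real)) set" where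
  "Y_omega k = (SIGMA i:{1..}. Y_piece k i)"

definition X_2omega :: "(nat \<times> nat \<times> (nat \<Rightarrow> real)) set" where
  "X_2omega = (SIGMA k:{1..}. Y_omega k)"

text \<open>
  Since \<open>X_piece m i \<subseteq> X_piece n i\<close> for \<open>m \<le> n\<close>, the natural inclusion of \<open>X_omega m\<close> into
  \<open>X_omega n\<close> is a set inclusion as well.

  The function \<open>d_2omega\<close> violates the triangle inequality on \<open>X_2omega\<close>
  (\<open>d_2omega_no_triangle\<close>), because the factor in \<open>d_omega\<close> grows with the larger of the two outer
  indices. On each single piece \<open>Y_omega k\<close> it coincides with \<open>d_omega k\<close>.
\<close>

definition d_2omega ::
    "nat \<times> nat \<times> (nat \<Rightarrow> real) \<Rightarrow> nat \<times> nat \<times> (nat \<Rightarrow> real) \<Rightarrow> real" where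
  "d_2omega = (\<lambda>(m, x) (n, y).
     max (d_omega (max m n) x y) (real (\<Sum>i = min m n..<max m n. i)))"

lemma d_2omega_no_triangle:
  defines "p \<equiv> (2, 1, \<lambda>_. 0)" and "q \<equiv> (1, 1, \<lambda>_. 0)" and "r \<equiv> (1, 3, \<lambda>_. 0)"
  shows "{p, q, r} \<subseteq> X_2omega" and "d_2omega p r > d_2omega p q + d_2omega q r"
proof -
  have "0 \<in> pow2_multiples i" for i
    by (auto simp: pow2_multiples_def intro: image_eqI[of _ _ 0])
  then show "{p, q, r} \<subseteq> X_2omega"
    by (simp add: p_def q_def r_def X_2omega_def Y_omega_def Y_piece_def X_piece_def euclid_def)
  have max: "d_sup n (\<lambda>_. 0) (\<lambda>_. 0) = 0" if "n \<ge> 1" for n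
    using that by (simp add: d_sup_def)
  have "{1..<2} = {1::nat}" "{1..<3} = {1, 2::nat}"
    by auto
  then have sums: "sum real {1..<2} = 1" "sum real {1..<3} = 3"
    by simp_all
  have "d_2omega p q = 1" "d_2omega q r = 3" "d_2omega p r = 6"
    unfolding p_def q_def r_def d_2omega_def d_omega_def
    using sums max[of 1] max[of 3] by simp_all
  then show "d_2omega p r > d_2omega p q + d_2omega q r"
    by simp
qed

end

theory Submission
  imports Defs
begin

text \<open>
  Below \<open>\<omega> + \<omega>\<close>, the ordinal of a family \<open>M\<close> of finite sets is a matter of counting: \<open>Ord M \<le> n\<close>
  means that the members of \<open>M\<close> have at most \<open>n\<close> elements, and \<open>Ord M \<le> \<omega> + j\<close> means that for each
  set \<open>\<sigma>\<close> of \<open>j + 1\<close> numbers the members of the link \<open>M\<^sup>\<sigma>\<close> have bounded size. So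
  \<open>Ord M = \<omega> + \<omega>\<close> (\<open>Ord_eq_two_omegaI\<close>) amounts to two facts about covers of the space: each \<open>a\<close>
  admits a \<open>k\<close> such that all links of sets consisting of \<open>a\<close> and \<open>k\<close> further numbers are bounded in
  size, whereas for each \<open>k\<close> some set of \<open>k\<close> numbers has links of unbounded size.

  Bounded links (\<open>X_2omega_links_bounded\<close>). Fix \<open>a\<close>. Distinct points of outer index at least \<open>a\<close> have
  distance at least \<open>a\<close>, so the single family of scale \<open>a\<close> disposes of all of them, as singletons. The
  remaining points have at most \<open>a\<close> coordinates off the grid that belongs to their inner index. Let
  \<open>\<sigma>\<close> consist of \<open>a + 1\<close> further scales. If the mesh \<open>2\<^sup>p\<close> is large compared with \<open>\<sigma>\<close>, all pieces
  of large inner index lie in \<open>a\<close>-skeletons of grids of mesh \<open>2\<^sup>p\<close>, and such a skeleton is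
  covered by \<open>a + 1\<close> families of the scales in \<open>\<sigma>\<close>, with bounds that depend neither on the inner index
  nor on the dimension. The pieces that are left live in one fixed \<open>\<real>\<^sup>i\<close>, and any \<open>i + 1\<close> scales
  suffice for them.

  Unbounded links (\<open>X_2omega_links_unbounded\<close>). Let \<open>\<sigma>\<close> consist of \<open>K\<close> scales from \<open>3 \<cdot> 2\<^sup>K\<close> on
  and \<open>\<tau>\<close> of \<open>n\<close> scales that are huge compared with \<open>2\<^sup>n\<^sup>+\<^sup>K\<close>. The piece with indices \<open>K\<close> and
  \<open>n + K\<close> is the \<open>K\<close>-skeleton of a grid of mesh \<open>2\<^sup>n\<^sup>+\<^sup>K\<close>, thinned out to the lattice of mesh
  \<open>2\<^sup>K\<close>. At the scales of \<open>\<sigma>\<close> it looks \<open>K\<close>-dimensional, but at those of \<open>\<tau>\<close> it looks like the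
  whole \<open>\<real>\<^sup>n\<^sup>+\<^sup>K\<close>. A cover with scales \<open>\<sigma> \<union> \<tau>\<close> is pulled back along a map from the lattice
  \<open>\<nat>\<^sup>n\<^sup>+\<^sup>K\<close> that takes all points outside a neighbourhood of the dual \<open>(n - 1)\<close>-skeleton to the
  \<open>K\<close>-skeleton. That neighbourhood is covered by \<open>n\<close> small-scale families of its own, and each of
  them is absorbed by one of the \<open>n\<close> families of scale in \<open>\<tau>\<close>, which is far coarser. The result is a
  cover of \<open>\<nat>\<^sup>n\<^sup>+\<^sup>K\<close> by \<open>n + K\<close> sets with bounded components, and Kuhn's combinatorial lemma
  excludes such covers (\<open>lattice_not_covered_by_discrete_sets\<close>).

  As \<open>d_2omega\<close> violates the triangle inequality, it enters only through explicit estimates: it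
  dominates the differences of coordinates and the gaps between indices, and it is bounded in terms
  of them.
\<close>

section \<open>Ordinals below \<open>\<omega> + \<omega>\<close>\<close>

abbreviation two_omega_order :: "nat rel" where
  "two_omega_order \<equiv> nat_osum natLeq natLeq"

lemma two_omega_order: "Well_order two_omega_order" "Field two_omega_order = UNIV"
proof -
  show "Well_order two_omega_order"
    using Well_order_nat_osum natLeq_Well_order by blast
  show "Field two_omega_order = UNIV"
  proof (intro set_eqI iffI UNIV_I)
    fix a show "a \<in> Field two_omega_order"
      by (cases a rule: nat_parity_cases) (simp_all add: Field_natLeq)
  qed
qed

text \<open>
  The order on \<open>nat\<close> that represents \<open>\<omega> + \<omega>\<close> lists the even numbers before the odd ones, so
  \<open>segment (2 * n)\<close> is the ordinal \<open>n\<close> and \<open>segment (2 * n + 1)\<close> is \<open>\<omega> + n\<close>.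
  These are all the ordinals below \<open>\<omega> + \<omega>\<close>.
\<close>
lift_definition segment :: "nat \<Rightarrow> ordinal" is
  "\<lambda>a. Restr two_omega_order (underS two_omega_order a)"
  by (simp add: ordIso_reflexive Well_order_Restr two_omega_order(1))

lemma segment_less_two_omega: "segment a < two_omega"
  unfolding two_omega_def
  by transfer (simp add: underS_Restr_ordLess[OF two_omega_order(1)] two_omega_order(2))

lemma less_two_omegaE:
  assumes "\<beta> < two_omega"
  obtains a where "\<beta> = segment a"
proof -
  from assms have "\<exists>a. \<beta> = segment a"
    unfolding two_omega_def
  proof transfer
    fix t :: "nat rel"
    assume "(t, two_omega_order) \<in> ordLess" "(t, t) \<in> ordIso"
    then show "\<exists>a. (t, Restr two_omega_order (underS two_omega_order a)) \<in> ordIso"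
      using ordLess_iff_ordIso_Restr[OF two_omega_order(1)] unfolding ordLess_def by blast
  qed
  then show thesis using that by blast
qed

lemma segment_mono:
  assumes "(a, b) \<in> two_omega_order" "a \<noteq> b"
  shows "segment a < segment b"
proof -
  have wo: "wo_rel two_omega_order"
    using two_omega_order(1) by (simp add: wo_rel_def)
  have "underS two_omega_order a \<subseteq> underS two_omega_order b" "a \<in> underS two_omega_order b"
    using assms wo_rel.TRANS[OF wo] wo_rel.ANTISYM[OF wo] by (auto simp: underS_def dest: transD antisymD)
  then have "underS two_omega_order a \<subset> underS two_omega_order b"
    by (auto simp: underS_def)
  then have "(Restr two_omega_order (underS two_omega_order a),
      Restr two_omega_order (underS two_omega_order b)) \<in> ordLess"
    using ofilter_subset_ordLess[OF two_omega_order(1)] wo_rel.underS_ofilter[OF wo] by blast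
  then show ?thesis by transfer
qed

lemma segment_less_iff [simp]:
  "segment (2 * m) < segment (2 * n) \<longleftrightarrow> m < n"
  "segment (2 * m) < segment (Suc (2 * n))"
  "\<not> segment (Suc (2 * m)) < segment (2 * n)"
  "segment (Suc (2 * m)) < segment (Suc (2 * n)) \<longleftrightarrow> m < n"
proof -
  have even: "segment (2 * m) < segment (2 * n)" if "m < n" for m n
    by (rule segment_mono) (use that in \<open>auto simp: natLeq_def\<close>)
  have odd: "segment (Suc (2 * m)) < segment (Suc (2 * n))" if "m < n" for m n
    by (rule segment_mono) (use that in \<open>auto simp: natLeq_def\<close>)
  have mixed: "segment (2 * m) < segment (Suc (2 * n))" for m n
    by (rule segment_mono) (auto simp: Field_natLeq even_odd_simps)
  show "segment (2 * m) < segment (2 * n) \<longleftrightarrow> m < n"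
    using even[of m n] even[of n m] by (metis less_imp_not_less not_less_iff_gr_or_eq)
  show "segment (Suc (2 * m)) < segment (Suc (2 * n)) \<longleftrightarrow> m < n"
    using odd[of m n] odd[of n m] by (metis less_imp_not_less not_less_iff_gr_or_eq)
  show "segment (2 * m) < segment (Suc (2 * n))" "\<not> segment (Suc (2 * m)) < segment (2 * n)"
    using mixed[of m n] mixed[of n m] by (auto dest: less_imp_not_less)
qed

lemma segment_0: "segment 0 = 0"
proof -
  have "\<not> 0 < segment 0"
  proof
    assume *: "0 < segment 0"
    then obtain a where a: "0 = segment a"
      using less_two_omegaE segment_less_two_omega less_trans by metis
    with * have "segment a < segment (2 * 0)" by simp
    then show False
      by (cases a rule: nat_parity_cases) (simp_all only: segment_less_iff not_less_zero)
  qed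
  then show ?thesis
    using zero_le_ordinal[of "segment 0"] by simp
qed

section \<open>\<open>Ord\<close> of a family below \<open>\<omega> + \<omega>\<close>\<close>

lemma link_subset_Fin: "link L M \<sigma> \<subseteq> Fin L"
  by (auto simp: link_def)

lemma Ord_le_mono:
  assumes "Ord_le L M \<alpha>" "\<alpha> \<le> \<beta>"
  shows "Ord_le L M \<beta>"
  using assms(1)
proof cases
  case Ord_le_zero
  have "link L {} {a} = {}" for a by (simp add: link_def)
  then have "0 < \<beta> \<Longrightarrow> Ord_le L {} \<beta>"
    by (rule_tac Ord_le.Ord_le_pos) (auto intro: Ord_le.Ord_le_zero)
  then show ?thesis
    using Ord_le_zero assms by (cases "\<beta> = 0") (auto simp: less_le)
next
  case Ord_le_pos
  then show ?thesis
    using assms(2) by (intro Ord_le.Ord_le_pos) (auto intro: less_le_trans)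
qed

lemma Ord_less_segment_iff:
  "Ord_less L M (segment (2 * Suc n)) \<longleftrightarrow> Ord_le L M (segment (2 * n))"
  "Ord_less L M (segment (Suc 0)) \<longleftrightarrow> (\<exists>n. Ord_le L M (segment (2 * n)))"
  "Ord_less L M (segment (Suc (2 * Suc n))) \<longleftrightarrow> Ord_le L M (segment (Suc (2 * n)))"
  "Ord_less L M two_omega \<longleftrightarrow> (\<exists>n. Ord_le L M (segment (Suc (2 * n))))"
proof -
  have *: "\<exists>a. \<beta> = segment (2 * a) \<or> \<beta> = segment (Suc (2 * a))" if "\<beta> < two_omega" for \<beta>
    by (metis less_two_omegaE[OF that] nat_parity_cases)
  have le: "segment (2 * m) \<le> segment (2 * n) \<longleftrightarrow> m \<le> n"
    "segment (2 * m) \<le> segment (Suc (2 * n))"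
    "segment (Suc (2 * m)) \<le> segment (Suc (2 * n)) \<longleftrightarrow> m \<le> n" for m n
    by (auto simp flip: not_less simp del: mult_Suc_right)
  have lt: "\<beta> < two_omega" if "\<beta> < segment a" for \<beta> a
    using that segment_less_two_omega less_trans by blast
  have 1: "\<beta> \<le> segment (2 * n)" if "\<beta> < segment (2 * Suc n)" for \<beta>
    using *[OF lt[OF that]] that by (auto simp: le simp del: mult_Suc_right)
  have 2: "\<exists>n. \<beta> \<le> segment (2 * n)" if "\<beta> < segment (Suc 0)" for \<beta>
    using *[OF lt[OF that]] that segment_less_iff(4)[of _ 0] by auto
  have 3: "\<beta> \<le> segment (Suc (2 * n))" if "\<beta> < segment (Suc (2 * Suc n))" for \<beta>
    using *[OF lt[OF that]] that by (auto simp: le simp del: mult_Suc_right)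
  have 4: "\<exists>n. \<beta> \<le> segment (Suc (2 * n))" if "\<beta> < two_omega" for \<beta>
    using *[OF that] le(2) by fastforce
  show "Ord_less L M (segment (2 * Suc n)) \<longleftrightarrow> Ord_le L M (segment (2 * n))"
    unfolding Ord_less_def using 1 Ord_le_mono segment_less_iff(1) by blast
  show "Ord_less L M (segment (Suc 0)) \<longleftrightarrow> (\<exists>n. Ord_le L M (segment (2 * n)))"
    unfolding Ord_less_def using 2 Ord_le_mono segment_less_iff(2)[of _ 0] by fastforce
  show "Ord_less L M (segment (Suc (2 * Suc n))) \<longleftrightarrow> Ord_le L M (segment (Suc (2 * n)))"
    unfolding Ord_less_def using 3 Ord_le_mono segment_less_iff(4) by blast
  show "Ord_less L M two_omega \<longleftrightarrow> (\<exists>n. Ord_le L M (segment (Suc (2 * n))))"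
    unfolding Ord_less_def using 4 Ord_le_mono segment_less_two_omega by blast
qed

lemma segment_pos: "0 < segment (2 * Suc n)" "0 < segment (Suc (2 * n))" "0 < two_omega"
  using segment_less_iff(1)[of 0 "Suc n"] segment_less_iff(2)[of 0 n] segment_less_two_omega[of 0]
  by (simp_all add: segment_0)

text \<open>
  Passing to the link of a point lowers both the ordinal and the sizes by one. At zero, the bound
  on sizes says that the family is empty because the empty set is not in \<open>Fin L\<close>.
\<close>
lemma Ord_le_finite_iff:
  assumes "M \<subseteq> Fin L"
  shows "Ord_le L M (segment (2 * n)) \<longleftrightarrow> (\<forall>\<sigma>\<in>M. card \<sigma> \<le> n)"
  using assms
proof (induction n arbitrary: M)
  case 0
  have "card \<sigma> \<noteq> 0" if "\<sigma> \<in> M" for \<sigma>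
    using that 0 by (auto simp: Fin_def)
  then show ?case
    by (auto simp: segment_0 Ord_le_0_iff)
next
  case (Suc n)
  have "Ord_le L M (segment (2 * Suc n)) \<longleftrightarrow> (\<forall>a\<in>L. \<forall>\<tau>\<in>link L M {a}. card \<tau> \<le> n)"
    by (simp only: Ord_le_pos_iff segment_pos Ord_less_segment_iff Suc.IH[OF link_subset_Fin])
  also have "\<dots> \<longleftrightarrow> (\<forall>\<sigma>\<in>M. card \<sigma> \<le> Suc n)"
  proof (intro iffI ballI)
    fix \<sigma> assume *: "\<forall>a\<in>L. \<forall>\<tau>\<in>link L M {a}. card \<tau> \<le> n" and "\<sigma> \<in> M"
    then have \<sigma>: "finite \<sigma>" "\<sigma> \<noteq> {}" "\<sigma> \<subseteq> L"
      using Suc.prems by (auto simp: Fin_def)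
    then obtain a where "a \<in> \<sigma>" by blast
    then have "\<sigma> - {a} = {} \<or> \<sigma> - {a} \<in> link L M {a}"
      using \<sigma> \<open>\<sigma> \<in> M\<close> by (auto simp: link_def Fin_def insert_absorb)
    then have "card (\<sigma> - {a}) \<le> n"
      using * \<open>a \<in> \<sigma>\<close> \<sigma>(3) by (metis card.empty subsetD zero_le)
    then show "card \<sigma> \<le> Suc n"
      using \<open>a \<in> \<sigma>\<close> \<sigma>(1) by (simp add: card_Diff_singleton)
  next
    fix a \<tau> assume *: "\<forall>\<sigma>\<in>M. card \<sigma> \<le> Suc n" and "\<tau> \<in> link L M {a}"
    then have "insert a \<tau> \<in> M" "a \<notin> \<tau>" "finite \<tau>"
      by (auto simp: link_def Fin_def)
    with * show "card \<tau> \<le> n" by fastforce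
  qed
  finally show ?case .
qed

lemma link_insert:
  "a \<notin> \<sigma> \<Longrightarrow> \<sigma> \<subseteq> L \<Longrightarrow> finite \<sigma> \<Longrightarrow> \<sigma> \<noteq> {} \<Longrightarrow> link L (link L M {a}) \<sigma> = link L M (insert a \<sigma>)"
  by (auto simp: link_def Fin_def)

text \<open>
  Each step down from \<open>\<omega> + j\<close> removes one number from the sets, and the last step, from \<open>\<omega>\<close> to some
  finite ordinal, another one. The finite ordinal may depend on the \<open>j + 1\<close> numbers removed.
\<close>
lemma Ord_le_omega_plus_iff:
  assumes "M \<subseteq> Fin L"
  shows "Ord_le L M (segment (Suc (2 * j))) \<longleftrightarrow>
    (\<forall>\<sigma>\<subseteq>L. card \<sigma> = Suc j \<longrightarrow> (\<exists>n. \<forall>\<tau>\<in>link L M \<sigma>. card \<tau> \<le> n))"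
  using assms
proof (induction j arbitrary: M)
  case 0
  have "Ord_le L M (segment (Suc (2 * 0))) \<longleftrightarrow> (\<forall>a\<in>L. \<exists>n. \<forall>\<tau>\<in>link L M {a}. card \<tau> \<le> n)"
    by (simp add: Ord_le_pos_iff segment_pos(2)[of 0, simplified] Ord_less_segment_iff
      Ord_le_finite_iff[OF link_subset_Fin])
  then show ?case
    by (auto simp: card_1_singleton_iff)
next
  case (Suc j)
  let ?bounded = "\<lambda>M \<sigma>. \<exists>n. \<forall>\<tau>\<in>link L M \<sigma>. card \<tau> \<le> n"
  have "Ord_le L M (segment (Suc (2 * Suc j))) \<longleftrightarrow>
      (\<forall>a\<in>L. \<forall>\<sigma>\<subseteq>L. card \<sigma> = Suc j \<longrightarrow> ?bounded (link L M {a}) \<sigma>)"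
    by (simp only: Ord_le_pos_iff segment_pos Ord_less_segment_iff Suc.IH[OF link_subset_Fin])
  also have "\<dots> \<longleftrightarrow> (\<forall>\<sigma>\<subseteq>L. card \<sigma> = Suc (Suc j) \<longrightarrow> ?bounded M \<sigma>)"
  proof (intro iffI allI ballI impI)
    fix \<sigma> assume *: "\<forall>a\<in>L. \<forall>\<sigma>\<subseteq>L. card \<sigma> = Suc j \<longrightarrow> ?bounded (link L M {a}) \<sigma>"
      and \<sigma>: "\<sigma> \<subseteq> L" "card \<sigma> = Suc (Suc j)"
    from \<sigma>(2) obtain a \<sigma>' where a: "\<sigma> = insert a \<sigma>'" "a \<notin> \<sigma>'" "card \<sigma>' = Suc j"
      by (metis card_Suc_eq)
    then have "finite \<sigma>'" "\<sigma>' \<noteq> {}"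
      using card.infinite by fastforce+
    with a \<sigma>(1) have "link L M \<sigma> = link L (link L M {a}) \<sigma>'"
      using link_insert[of a \<sigma>' L M] by simp
    with * a \<sigma>(1) show "?bounded M \<sigma>" by simp
  next
    fix a \<sigma> assume *: "\<forall>\<sigma>\<subseteq>L. card \<sigma> = Suc (Suc j) \<longrightarrow> ?bounded M \<sigma>"
      and \<sigma>: "a \<in> L" "\<sigma> \<subseteq> L" "card \<sigma> = Suc j"
    show "?bounded (link L M {a}) \<sigma>"
    proof (cases "a \<in> \<sigma>")
      case True
      then have "link L (link L M {a}) \<sigma> = {}"
        by (auto simp: link_def)
      then show ?thesis by simp
    next
      case False
      have "finite \<sigma>" "\<sigma> \<noteq> {}"
        using \<sigma>(3) card.infinite by fastforce+
      then have "link L (link L M {a}) \<sigma> = link L M (insert a \<sigma>)" "card (insert a \<sigma>) = Suc (Suc j)"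
        using False \<sigma> link_insert[of a \<sigma> L M] by simp_all
      with * \<sigma> show ?thesis by simp
    qed
  qed
  finally show ?case .
qed

text \<open>
  The interface between ordinals and covers. In \<open>upper\<close> the number \<open>k\<close> is chosen after \<open>a\<close>: this is
  what the first step down from \<open>\<omega> + \<omega>\<close>, to some \<open>\<omega> + k\<close>, allows.
\<close>
lemma Ord_eq_two_omegaI:
  assumes "M \<subseteq> Fin L"
    and upper: "\<And>a. a \<in> L \<Longrightarrow> \<exists>k>0. \<forall>\<sigma>\<subseteq>L. card \<sigma> = k \<longrightarrow> a \<notin> \<sigma> \<longrightarrow>
      (\<exists>n. \<forall>\<tau>\<in>link L M (insert a \<sigma>). card \<tau> \<le> n)"
    and lower: "\<And>k. k > 0 \<Longrightarrow> \<exists>\<sigma>\<subseteq>L. card \<sigma> = k \<and> (\<forall>n. \<exists>\<tau>\<in>link L M \<sigma>. card \<tau> > n)"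
  shows "Ord L M = Ordinal two_omega"
  unfolding Ord_eq_Ordinal_iff
proof
  show "Ord_le L M two_omega"
    unfolding Ord_le_pos_iff[OF segment_pos(3)] Ord_less_segment_iff(4)
  proof
    fix a assume "a \<in> L"
    from upper[OF this] obtain j where
      j: "\<And>\<sigma>. \<sigma> \<subseteq> L \<Longrightarrow> card \<sigma> = Suc j \<Longrightarrow> a \<notin> \<sigma> \<Longrightarrow> \<exists>n. \<forall>\<tau>\<in>link L M (insert a \<sigma>). card \<tau> \<le> n"
      by (metis gr0_implies_Suc)
    have "\<exists>n. \<forall>\<tau>\<in>link L (link L M {a}) \<sigma>. card \<tau> \<le> n" if \<sigma>: "\<sigma> \<subseteq> L" "card \<sigma> = Suc j" for \<sigma>
    proof (cases "a \<in> \<sigma>")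
      case True
      then have "link L (link L M {a}) \<sigma> = {}"
        by (auto simp: link_def)
      then show ?thesis by simp
    next
      case False
      have "finite \<sigma>" "\<sigma> \<noteq> {}"
        using \<sigma>(2) card.infinite by fastforce+
      then show ?thesis
        using False j[OF \<sigma>] \<sigma> link_insert[of a \<sigma> L M] by simp
    qed
    then show "\<exists>n. Ord_le L (link L M {a}) (segment (Suc (2 * n)))"
      using Ord_le_omega_plus_iff[OF link_subset_Fin] by blast
  qed
  show "\<not> Ord_less L M two_omega"
  proof
    assume "Ord_less L M two_omega"
    then obtain j where "Ord_le L M (segment (Suc (2 * j)))"
      by (auto simp: Ord_less_segment_iff)
    then have "\<forall>\<sigma>\<subseteq>L. card \<sigma> = Suc j \<longrightarrow> (\<exists>n. \<forall>\<tau>\<in>link L M \<sigma>. card \<tau> \<le> n)"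
      using Ord_le_omega_plus_iff[OF assms(1)] by blast
    with lower[of "Suc j"] show False
      by (meson not_less zero_less_Suc)
  qed
qed

section \<open>Discrete sets at a given scale\<close>

text \<open>
  The sets that one family of scale \<open>r\<close> can cover exactly. If \<open>d\<close> is a metric, this says that the
  \<open>r\<close>-components of \<open>S\<close> are uniformly bounded.
\<close>
definition discrete_at :: "('a \<Rightarrow> 'a \<Rightarrow> real) \<Rightarrow> real \<Rightarrow> 'a set \<Rightarrow> bool" where
  "discrete_at d r S \<longleftrightarrow> (\<exists>\<V>. \<Union>\<V> = S \<and> uniformly_bounded d \<V> \<and> r_disjoint d r \<V>)"

text \<open>
  Instead of a family of sets it is often easier to give a labelling of the points that is
  constant at scale \<open>r\<close> and whose fibres are bounded; the family consists of the fibres.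
\<close>
lemma discrete_atI:
  fixes b :: "'a \<Rightarrow> 'c"
  assumes near: "\<And>x y. x \<in> S \<Longrightarrow> y \<in> S \<Longrightarrow> d x y < r \<Longrightarrow> b x = b y"
    and bounded: "\<And>x y. x \<in> S \<Longrightarrow> y \<in> S \<Longrightarrow> b x = b y \<Longrightarrow> d x y \<le> C"
  shows "discrete_at d r S"
  unfolding discrete_at_def
proof (intro exI[of _ "(\<lambda>x. {y \<in> S. b y = b x}) ` S"] conjI)
  let ?\<V> = "(\<lambda>x. {y \<in> S. b y = b x}) ` S"
  show "\<Union>?\<V> = S" by auto
  have "diam d A \<le> ereal (max C 1)" if "A \<in> ?\<V>" for A
    using that bounded by (auto simp: diam_def intro!: SUP_least max.coboundedI1)
  then show "uniformly_bounded d ?\<V>"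
    unfolding uniformly_bounded_def by (intro exI[of _ "max C 1"]) auto
  have "ereal r \<le> dist_sets d A B" if AB: "A \<in> ?\<V>" "B \<in> ?\<V>" "A \<noteq> B" for A B
    unfolding dist_sets_def
  proof (intro INF_greatest)
    fix x y assume "x \<in> A" "y \<in> B"
    with AB have "x \<in> S" "y \<in> S" "b x \<noteq> b y" by auto
    with near show "ereal r \<le> ereal (d x y)" by (force simp: not_less)
  qed
  then show "r_disjoint d r ?\<V>"
    unfolding r_disjoint_def by blast
qed

text \<open>
  Distinct members of a family may overlap where \<open>d x x \<ge> r\<close>, so the label of a point is a chosen
  member that contains it.
\<close>
lemma discrete_atE:
  fixes S :: "'a set"
  assumes "discrete_at d r S"
  obtains b :: "'a \<Rightarrow> 'a set" and C where
    "\<forall>x\<in>S. \<forall>y\<in>S. d x y < r \<longrightarrow> b x = b y"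
    "\<forall>x\<in>S. \<forall>y\<in>S. b x = b y \<longrightarrow> d x y \<le> C"
proof -
  obtain \<V> where \<V>: "\<Union>\<V> = S" and "uniformly_bounded d \<V>" and "r_disjoint d r \<V>"
    using assms unfolding discrete_at_def by blast
  then obtain C where C: "\<And>A. A \<in> \<V> \<Longrightarrow> diam d A \<le> ereal C"
    and disj: "\<And>A B. A \<in> \<V> \<Longrightarrow> B \<in> \<V> \<Longrightarrow> A \<noteq> B \<Longrightarrow> ereal r \<le> dist_sets d A B"
    unfolding uniformly_bounded_def r_disjoint_def by auto
  define b where "b x = (SOME A. A \<in> \<V> \<and> x \<in> A)" for x
  have b: "b x \<in> \<V>" "x \<in> b x" if "x \<in> S" for x
  proof -
    have "\<exists>A. A \<in> \<V> \<and> x \<in> A" using that \<V> by blast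
    from someI_ex[OF this] show "b x \<in> \<V>" "x \<in> b x" by (simp_all add: b_def)
  qed
  have "(d x y < r \<longrightarrow> b x = b y) \<and> (b x = b y \<longrightarrow> d x y \<le> C)" if xy: "x \<in> S" "y \<in> S" for x y
  proof (intro conjI impI)
    have "dist_sets d (b x) (b y) \<le> ereal (d x y)"
      unfolding dist_sets_def using b xy by (intro INF_lower2[of x] INF_lower2[of y]) auto
    moreover have "ereal r \<le> dist_sets d (b x) (b y)" if "b x \<noteq> b y"
      using that disj b xy by blast
    ultimately show "b x = b y" if "d x y < r"
      using that by (metis ereal_less_eq(3) not_less order_trans)
    have "ereal (d x y) \<le> diam d (b x)" if "b x = b y"
      unfolding diam_def using b xy that by (intro SUP_upper2[of x] SUP_upper2[of y]) auto
    moreover have "diam d (b x) \<le> ereal C"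
      using C b xy by blast
    ultimately show "d x y \<le> C" if "b x = b y"
      using that by (metis ereal_less_eq(3) order_trans)
  qed
  then show thesis
    by (intro that[of b C]) blast+
qed

lemma A_family_iff:
  assumes "\<sigma> \<in> Fin {1..}"
  shows "\<sigma> \<in> A_family X d \<longleftrightarrow>
    (\<nexists>S. (\<forall>i\<in>\<sigma>. S i \<subseteq> X \<and> discrete_at d (real i) (S i)) \<and> X \<subseteq> (\<Union>i\<in>\<sigma>. S i))"
proof -
  have "(\<exists>\<V>. (\<forall>i\<in>\<sigma>. \<V> i \<subseteq> Pow X \<and> uniformly_bounded d (\<V> i) \<and> r_disjoint d (real i) (\<V> i)) \<and>
             X \<subseteq> \<Union> (\<Union>i\<in>\<sigma>. \<V> i)) \<longleftrightarrow>
    (\<exists>S. (\<forall>i\<in>\<sigma>. S i \<subseteq> X \<and> discrete_at d (real i) (S i)) \<and> X \<subseteq> (\<Union>i\<in>\<sigma>. S i))" (is "?L \<longleftrightarrow> ?R")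
  proof
    assume ?L
    then obtain \<V> where \<V>: "X \<subseteq> \<Union> (\<Union>i\<in>\<sigma>. \<V> i)" and
      "\<forall>i\<in>\<sigma>. \<V> i \<subseteq> Pow X \<and> uniformly_bounded d (\<V> i) \<and> r_disjoint d (real i) (\<V> i)"
      by (elim exE conjE)
    then have "\<forall>i\<in>\<sigma>. \<Union>(\<V> i) \<subseteq> X \<and> discrete_at d (real i) (\<Union>(\<V> i))"
      unfolding discrete_at_def by auto
    moreover have "X \<subseteq> (\<Union>i\<in>\<sigma>. \<Union>(\<V> i))"
      using \<V> by (rule order_trans) blast
    ultimately show ?R by (intro exI[of _ "\<lambda>i. \<Union>(\<V> i)"]) simp
  next
    assume ?R
    then obtain S where X: "X \<subseteq> (\<Union>i\<in>\<sigma>. S i)" and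
      S: "\<forall>i\<in>\<sigma>. S i \<subseteq> X \<and> discrete_at d (real i) (S i)"
      by (elim exE conjE)
    then have "\<forall>i\<in>\<sigma>. \<exists>\<V>. \<Union>\<V> = S i \<and> uniformly_bounded d \<V> \<and> r_disjoint d (real i) \<V>"
      unfolding discrete_at_def by simp
    then obtain \<V> where
      \<V>: "\<forall>i\<in>\<sigma>. \<Union>(\<V> i) = S i \<and> uniformly_bounded d (\<V> i) \<and> r_disjoint d (real i) (\<V> i)"
      by (elim bchoice[THEN exE])
    have "X \<subseteq> \<Union> (\<Union>i\<in>\<sigma>. \<V> i)"
      using X \<V> by fastforce
    moreover have "\<forall>i\<in>\<sigma>. \<V> i \<subseteq> Pow X"
      using S \<V> by fastforce
    ultimately show ?L using \<V> by (intro exI[of _ \<V>]) simp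
  qed
  with assms show ?thesis
    unfolding A_family_def mem_Collect_eq by (simp only: simp_thms)
qed

lemma discrete_at_vimage:
  fixes f :: "'b \<Rightarrow> 'a"
  assumes S: "discrete_at d r S" and f: "\<And>x. x \<in> T \<Longrightarrow> f x \<in> S"
    and near: "\<And>x y. x \<in> T \<Longrightarrow> y \<in> T \<Longrightarrow> e x y < r' \<Longrightarrow> d (f x) (f y) < r"
    and proper: "\<And>C. \<exists>C'. \<forall>x\<in>T. \<forall>y\<in>T. d (f x) (f y) \<le> C \<longrightarrow> e x y \<le> C'"
  shows "discrete_at e r' T"
proof -
  obtain b :: "'a \<Rightarrow> 'a set" and C where
    b: "\<forall>x\<in>S. \<forall>y\<in>S. d x y < r \<longrightarrow> b x = b y" "\<forall>x\<in>S. \<forall>y\<in>S. b x = b y \<longrightarrow> d x y \<le> C"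
    by (rule discrete_atE[OF S])
  obtain C' where C': "\<forall>x\<in>T. \<forall>y\<in>T. d (f x) (f y) \<le> C \<longrightarrow> e x y \<le> C'"
    using proper by blast
  show ?thesis
  proof (rule discrete_atI[where b = "\<lambda>x. b (f x)" and C = C'])
    fix x y assume xy: "x \<in> T" "y \<in> T"
    show "b (f x) = b (f y)" if "e x y < r'"
      using b(1) f near xy that by simp
    show "e x y \<le> C'" if "b (f x) = b (f y)"
      using b(2) f xy that C' by simp
  qed
qed

text \<open>
  A set \<open>U\<close> whose blocks have diameter at most \<open>B\<close> can be absorbed by a set \<open>Q\<close> that is discrete at a
  much larger scale. Each block of \<open>U\<close> comes close to at most one block of \<open>Q\<close>, because two such
  blocks of \<open>Q\<close> would contain points less than \<open>r + B + r\<close> apart; it is merged with that block. Thus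
  no block of \<open>U\<close> ever links two blocks of \<open>Q\<close>, and those of \<open>Q\<close> grow by at most \<open>r + B\<close> on each
  side.
\<close>
lemma discrete_at_saturated_union:
  fixes d :: "'a \<Rightarrow> 'a \<Rightarrow> real" and c :: "'a \<Rightarrow> 'c"
  assumes sym: "\<And>x y. d x y = d y x" and triangle: "\<And>x y z. d x z \<le> d x y + d y z"
    and refl: "\<And>x. d x x = 0"
    and Q: "discrete_at d (2 * r + B) Q" and pos: "0 \<le> r" "0 \<le> B" and disj: "Q \<inter> U = {}"
    and U_near: "\<And>x y. x \<in> U \<Longrightarrow> y \<in> U \<Longrightarrow> d x y < r \<Longrightarrow> c x = c y"
    and U_bounded: "\<And>x y. x \<in> U \<Longrightarrow> y \<in> U \<Longrightarrow> c x = c y \<Longrightarrow> d x y \<le> B"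
  shows "discrete_at d r (Q \<union> U)"
proof -
  obtain v :: "'a \<Rightarrow> 'a set" and C where
    v: "\<forall>x\<in>Q. \<forall>y\<in>Q. d x y < 2 * r + B \<longrightarrow> v x = v y" "\<forall>x\<in>Q. \<forall>y\<in>Q. v x = v y \<longrightarrow> d x y \<le> C"
    by (rule discrete_atE[OF Q])
  define touches where "touches k q \<longleftrightarrow> q \<in> Q \<and> (\<exists>u\<in>U. c u = k \<and> d u q < r)" for k q
  have touches_unique: "v q = v q'" if qq': "touches k q" "touches k q'" for k q q'
  proof -
    obtain u u' where u: "u \<in> U" "u' \<in> U" "c u = k" "c u' = k" "d u q < r" "d u' q' < r"
      and q: "q \<in> Q" "q' \<in> Q"
      using qq' unfolding touches_def by blast
    have "d u u' \<le> B"
      using u by (intro U_bounded) auto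
    then have "d q q' < 2 * r + B"
      using u triangle[of q q' u] triangle[of u q' u'] sym[of q u] by linarith
    with v(1) q show ?thesis by blast
  qed
  define b where "b x = (if x \<in> Q then Inl (v x)
     else if \<exists>q. touches (c x) q then Inl (v (SOME q. touches (c x) q)) else Inr (c x))" for x
  have b_Q: "b x = Inl (v x)" if "x \<in> Q" for x
    using that by (simp add: b_def)
  have b_touches: "b x = Inl (v q)" if "x \<in> U" "touches (c x) q" for x q
  proof -
    have "touches (c x) (SOME q. touches (c x) q)"
      using that(2) by (rule someI)
    then have "v (SOME q. touches (c x) q) = v q"
      using touches_unique that(2) by blast
    moreover have "x \<notin> Q" using that(1) disj by blast
    ultimately show ?thesis
      using that(2) unfolding b_def by auto
  qed
  have b_free: "b x = Inr (c x)" if "x \<in> U" "\<nexists>q. touches (c x) q" for x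
    using that disj by (auto simp: b_def)
  have b_Inl: "\<exists>q\<in>Q. v q = w \<and> d x q \<le> r + B" if x: "x \<in> Q \<union> U" and w: "b x = Inl w" for x w
  proof (cases "x \<in> Q")
    case True
    with w b_Q refl pos show ?thesis by (intro bexI[of _ x]) auto
  next
    case False
    with x have "x \<in> U" by simp
    with w b_free obtain q where q: "touches (c x) q" by fastforce
    then obtain u where u: "u \<in> U" "c u = c x" "d u q < r" "q \<in> Q"
      unfolding touches_def by blast
    have "d x u \<le> B" using U_bounded \<open>x \<in> U\<close> u by simp
    then have "d x q \<le> r + B" using triangle[of x q u] u(3) by linarith
    with b_touches[OF \<open>x \<in> U\<close> q] w u(4) show ?thesis by auto
  qed
  have b_Inr: "x \<in> U \<and> c x = k" if x: "x \<in> Q \<union> U" and k: "b x = Inr k" for x k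
  proof -
    have "x \<in> U" using x k b_Q by auto
    moreover have "\<nexists>q. touches (c x) q" using b_touches[OF \<open>x \<in> U\<close>] k by auto
    ultimately show ?thesis using b_free k by auto
  qed
  have mixed: "b x = b y" if "x \<in> Q" "y \<in> U" "d x y < r" for x y
  proof -
    have "touches (c y) x" using that sym unfolding touches_def by auto
    with that b_Q b_touches show ?thesis by simp
  qed
  show ?thesis
  proof (rule discrete_atI[where b = b and C = "max B (C + (r + B) + (r + B))"])
    fix x y assume xy: "x \<in> Q \<union> U" "y \<in> Q \<union> U"
    show "b x = b y" if less: "d x y < r"
    proof -
      consider "x \<in> Q" "y \<in> Q" | "x \<in> Q" "y \<in> U" | "x \<in> U" "y \<in> Q" | "x \<in> U" "y \<in> U"
        using xy by blast
      then show ?thesis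
      proof cases
        case 1
        with v(1) less pos have "v x = v y" by simp
        with 1 b_Q show ?thesis by simp
      next
        case 2
        with less mixed show ?thesis by blast
      next
        case 3
        with less mixed[of y x] sym show ?thesis by simp
      next
        case 4
        then have "c x = c y" using U_near less by blast
        moreover have "x \<notin> Q" "y \<notin> Q" using 4 disj by auto
        ultimately show ?thesis by (simp add: b_def)
      qed
    qed
    assume eq: "b x = b y"
    show "d x y \<le> max B (C + (r + B) + (r + B))"
    proof (cases "b x")
      case (Inl w)
      then obtain q q' where q: "q \<in> Q" "q' \<in> Q" "v q = w" "v q' = w" "d x q \<le> r + B" "d y q' \<le> r + B"
        using b_Inl[OF xy(1), of w] b_Inl[OF xy(2), of w] eq by auto
      have "d q q' \<le> C" using v(2) q by simp
      then have "d x y \<le> C + (r + B) + (r + B)"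
        using q triangle[of x y q] triangle[of q y q'] sym[of y q'] by linarith
      then show ?thesis by simp
    next
      case (Inr k)
      then have "x \<in> U" "y \<in> U" "c x = c y"
        using b_Inr[OF xy(1), of k] b_Inr[OF xy(2), of k] eq by auto
      with U_bounded show ?thesis by (simp add: max.coboundedI1)
    qed
  qed
qed

section \<open>Covering the skeleton of a grid\<close>

text \<open>
  The points with at most \<open>k\<close> coordinates far from the grid \<open>L \<cdot> \<int>\<close> are split into \<open>k + 1\<close> layers, so
  that within a layer points in different cells are far apart. Enlarge the radius \<open>r\<close> in steps of \<open>s\<close>.
  The set of far coordinates shrinks, and as it has at most \<open>k\<close> elements, it stays the same in one of
  the first \<open>k + 1\<close> steps. In the layer of that step no coordinate is at the boundary between near
  and far: moving by less than \<open>s\<close> within the layer changes neither the set of far coordinates, nor the grid point next to a near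
  coordinate, nor the grid interval that contains a far one.
\<close>
definition grid_dist :: "real \<Rightarrow> real \<Rightarrow> real" where
  "grid_dist L z = \<bar>z - L * of_int (round (z / L))\<bar>"

lemma grid_dist_le:
  assumes "L > 0"
  shows "grid_dist L z \<le> \<bar>z - L * of_int m\<bar>"
proof -
  have *: "\<bar>z - L * of_int k\<bar> = L * \<bar>z / L - of_int k\<bar>" for k :: int
  proof -
    have "z - L * of_int k = L * (z / L - of_int k)"
      using assms by (simp add: field_simps)
    then show ?thesis
      using assms by (simp only: abs_mult abs_of_pos)
  qed
  show ?thesis
    unfolding grid_dist_def * using assms round_diff_minimal by (intro mult_left_mono) auto
qed

lemma grid_dist_lipschitz:
  assumes "L > 0"
  shows "grid_dist L z \<le> grid_dist L z' + \<bar>z - z'\<bar>"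
  using grid_dist_le[OF assms, of z "round (z' / L)"] by (simp add: grid_dist_def)

definition far :: "real \<Rightarrow> real \<Rightarrow> 'i set \<Rightarrow> ('i \<Rightarrow> real) \<Rightarrow> 'i set" where
  "far L r I x = {l \<in> I. grid_dist L (x l) \<ge> r}"

definition layer :: "real \<Rightarrow> real \<Rightarrow> real \<Rightarrow> 'i set \<Rightarrow> nat \<Rightarrow> ('i \<Rightarrow> real) set" where
  "layer L r s I t = {x. far L (r + real t * s) I x = far L (r + real (Suc t) * s) I x}"

text \<open>
  The value outside \<open>I\<close> is fixed so that cells are equal if they agree on \<open>I\<close>.
\<close>
definition cell :: "real \<Rightarrow> real \<Rightarrow> 'i set \<Rightarrow> ('i \<Rightarrow> real) \<Rightarrow> 'i \<Rightarrow> bool \<times> int" where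
  "cell L r I x = (\<lambda>l. if l \<notin> I then undefined
     else if l \<in> far L r I x then (True, \<lfloor>x l / L\<rfloor>) else (False, round (x l / L)))"

text \<open>
  Otherwise the set of far coordinates would lose an element in each of the \<open>k + 1\<close> steps.
\<close>
lemma ex_layer:
  assumes "finite I" "s \<ge> 0" "card (far L r I x) \<le> k"
  shows "\<exists>t\<le>k. x \<in> layer L r s I t"
proof (rule ccontr)
  assume *: "\<not> (\<exists>t\<le>k. x \<in> layer L r s I t)"
  have "card (far L (r + real t * s) I x) + t \<le> k" if "t \<le> Suc k" for t
    using that
  proof (induction t)
    case 0
    then show ?case using assms(3) by simp
  next
    case (Suc t)
    have "far L (r + real (Suc t) * s) I x \<subseteq> far L (r + real t * s) I x"
      using assms(2) by (auto simp: far_def algebra_simps)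
    moreover have "far L (r + real (Suc t) * s) I x \<noteq> far L (r + real t * s) I x"
      using * Suc.prems by (auto simp: layer_def)
    ultimately have "card (far L (r + real (Suc t) * s) I x) < card (far L (r + real t * s) I x)"
      using assms(1) by (intro psubset_card_mono) (auto simp: far_def)
    then show ?case using Suc by simp
  qed
  from this[of "Suc k"] show False by simp
qed

text \<open>
  The two bounds on \<open>s\<close> separate neighbouring cells: far coordinates in adjacent intervals differ by
  at least twice the radius, and near coordinates at adjacent grid points by at least \<open>L\<close> minus
  twice the radius.
\<close>
lemma layer_near:
  assumes "x \<in> layer L r s I t" "y \<in> layer L r s I t"
    and near: "\<And>l. l \<in> I \<Longrightarrow> \<bar>x l - y l\<bar> < s"
    and "0 < s" "s \<le> 2 * r" "2 * (r + real t * s) + s \<le> L"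
  shows "cell L (r + real t * s) I x = cell L (r + real t * s) I y"
proof -
  define R where "R = r + real t * s"
  have R: "s \<le> 2 * R" "2 * R + s \<le> L"
    using assms by (auto simp: R_def intro: order_trans)
  then have "L > 0" using assms by linarith
  have far: "far L R I x = far L (R + s) I x" "far L R I y = far L (R + s) I y"
    using assms(1,2) by (simp_all add: layer_def R_def algebra_simps)
  have step: "far L (R + s) I u \<subseteq> far L R I v" if near: "\<And>l. l \<in> I \<Longrightarrow> \<bar>u l - v l\<bar> < s" for u v
  proof
    fix l assume "l \<in> far L (R + s) I u"
    then show "l \<in> far L R I v"
      using near[of l] grid_dist_lipschitz[OF \<open>L > 0\<close>, of "u l" "v l"] by (simp add: far_def)
  qed
  have "far L R I x = far L R I y"
    using step[of x y] step[of y x] near far by (simp add: abs_minus_commute subset_antisym)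
  moreover have "round (x l / L) = round (y l / L)" if l: "l \<in> I" "l \<notin> far L R I x" "l \<notin> far L R I y" for l
  proof -
    have "L * \<bar>of_int (round (x l / L)) - of_int (round (y l / L))\<bar> =
        \<bar>L * of_int (round (x l / L)) - L * of_int (round (y l / L))\<bar>"
      using \<open>L > 0\<close> by (simp only: abs_mult abs_of_pos flip: right_diff_distrib)
    also have "\<dots> < L * 1"
      using l near[OF l(1)] R(2) unfolding far_def grid_dist_def by (simp add: abs_if split: if_splits)
    finally have "real_of_int \<bar>round (x l / L) - round (y l / L)\<bar> < 1"
      using \<open>L > 0\<close> by (simp add: mult_less_cancel_left)
    then show ?thesis by linarith
  qed
  moreover have "\<lfloor>u / L\<rfloor> \<le> \<lfloor>v / L\<rfloor>" if uv: "grid_dist L u \<ge> R" "grid_dist L v \<ge> R" "\<bar>u - v\<bar> < s" for u v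
  proof (rule ccontr)
    assume "\<not> \<lfloor>u / L\<rfloor> \<le> \<lfloor>v / L\<rfloor>"
    then have "v / L < of_int \<lfloor>u / L\<rfloor>" by linarith
    then have "v < L * of_int \<lfloor>u / L\<rfloor>" "L * of_int \<lfloor>u / L\<rfloor> \<le> u"
      using \<open>L > 0\<close> floor_divide_lower[of L u] by (simp_all add: field_simps)
    with grid_dist_le[OF \<open>L > 0\<close>, of u "\<lfloor>u / L\<rfloor>"] grid_dist_le[OF \<open>L > 0\<close>, of v "\<lfloor>u / L\<rfloor>"] uv R(1)
    show False by linarith
  qed
  then have "\<lfloor>x l / L\<rfloor> = \<lfloor>y l / L\<rfloor>" if "l \<in> far L R I x" "l \<in> far L R I y" for l
    using that near[of l] by (intro antisym) (simp_all add: far_def abs_minus_commute)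
  ultimately show ?thesis
    unfolding R_def[symmetric] cell_def by auto
qed

lemma cell_eq_imp_near:
  assumes "cell L r I x = cell L r I y" "2 * r \<le> L" "L > 0" "l \<in> I"
  shows "\<bar>x l - y l\<bar> \<le> L"
proof (cases "l \<in> far L r I x")
  case True
  then have "\<lfloor>x l / L\<rfloor> = \<lfloor>y l / L\<rfloor>"
    using fun_cong[OF assms(1), of l] \<open>l \<in> I\<close> unfolding cell_def by (auto split: if_splits)
  then have "\<bar>x l / L - y l / L\<bar> < 1" by linarith
  then have "\<bar>(x l - y l) / L\<bar> < 1" by (simp add: diff_divide_distrib)
  then show ?thesis using \<open>L > 0\<close> by (simp add: field_simps)
next
  case False
  then have "l \<notin> far L r I y" "round (x l / L) = round (y l / L)"
    using fun_cong[OF assms(1), of l] \<open>l \<in> I\<close> unfolding cell_def by (auto split: if_splits)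
  with False assms show ?thesis
    by (auto simp: far_def grid_dist_def abs_if split: if_splits)
qed

lemma far_skeleton_subset:
  assumes "L > 0" "r > 0"
  shows "far L r I x \<subseteq> {l \<in> I. x l \<notin> range (\<lambda>m. L * of_int m)}"
proof
  fix l assume l: "l \<in> far L r I x"
  have "x l \<noteq> L * of_int m" for m
    using l grid_dist_le[OF assms(1), of "x l" m] assms(2) by (auto simp: far_def)
  with l show "l \<in> {l \<in> I. x l \<notin> range (\<lambda>m. L * of_int m)}"
    by (auto simp: far_def)
qed

section \<open>Distances in the space\<close>

lemma mem_X_2omega: "(k, m, x) \<in> X_2omega \<longleftrightarrow> k \<ge> 1 \<and> m \<ge> 1 \<and> x \<in> Y_piece k m"
  by (auto simp: X_2omega_def Y_omega_def)

lemma d_2omega_eq: "d_2omega (k, m, x) (k', m', y) =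
    max (max (d_sup (max m m') x y) (real (max k k' * (\<Sum>i = min m m'..<max m m'. i))))
      (real (\<Sum>i = min k k'..<max k k'. i))"
  by (simp add: d_2omega_def d_omega_def)

lemma min_le_sum_interval:
  fixes m n :: nat
  assumes "m \<noteq> n"
  shows "min m n \<le> (\<Sum>i = min m n..<max m n. i)"
  using assms by (intro member_le_sum) auto

lemma coordinate_le_d_2omega:
  assumes "(k, m, x) \<in> X_2omega" "(k', m', y) \<in> X_2omega"
  shows "\<bar>x l - y l\<bar> \<le> d_2omega (k, m, x) (k', m', y)"
proof -
  have m: "m \<ge> 1" "x \<in> euclid m" "y \<in> euclid m'"
    using assms by (auto simp: mem_X_2omega Y_piece_def X_piece_def)
  have le: "\<bar>x l - y l\<bar> \<le> d_sup (max m m') x y" if "l \<in> {1..max m m'}" for l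
    unfolding d_sup_def using that by (intro Max_ge) auto
  then have "0 \<le> d_sup (max m m') x y"
    using m(1) by (intro order_trans[OF _ le[of 1]]) auto
  then have "\<bar>x l - y l\<bar> \<le> d_sup (max m m') x y"
    using le[of l] m by (cases "l \<in> {1..max m m'}") (auto simp: euclid_def)
  then show ?thesis
    unfolding d_2omega_eq by (intro max.coboundedI1)
qed

lemma outer_index_le_d_2omega:
  assumes "k \<noteq> k'"
  shows "real (min k k') \<le> d_2omega (k, m, x) (k', m', y)"
proof -
  have "real (min k k') \<le> real (\<Sum>i = min k k'..<max k k'. i)"
    using min_le_sum_interval[OF assms] by (simp only: of_nat_le_iff)
  then show ?thesis
    unfolding d_2omega_eq by (rule max.coboundedI2)
qed

text \<open>
  The factor \<open>max k k'\<close> matters where the outer indices are large: points with different inner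
  indices are then far apart even if the inner indices are small.
\<close>
lemma inner_index_le_d_2omega:
  assumes "m \<noteq> m'"
  shows "real (max k k' * min m m') \<le> d_2omega (k, m, x) (k', m', y)"
proof -
  have "max k k' * min m m' \<le> max k k' * (\<Sum>i = min m m'..<max m m'. i)"
    using min_le_sum_interval[OF assms] by (rule mult_le_mono2)
  then have "real (max k k' * min m m') \<le> real (max k k' * (\<Sum>i = min m m'..<max m m'. i))"
    by (simp only: of_nat_le_iff)
  then show ?thesis
    unfolding d_2omega_eq by (intro max.coboundedI1 max.coboundedI2)
qed

lemma d_2omega_le:
  assumes "(k, m, x) \<in> X_2omega" "(k', m', y) \<in> X_2omega"
    and coord: "\<And>l. l \<in> {1..max m m'} \<Longrightarrow> \<bar>x l - y l\<bar> \<le> C"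
    and k: "k \<le> a" "k' \<le> a" and m: "m = m' \<or> m \<le> b \<and> m' \<le> b"
  shows "d_2omega (k, m, x) (k', m', y) \<le>
    max C (max (real (a * (\<Sum>i<b. i))) (real (\<Sum>i<a. i)))"
proof -
  have sup: "d_sup (max m m') x y \<le> C"
    unfolding d_sup_def using coord assms(1) by (subst Max_le_iff) (auto simp: mem_X_2omega)
  have "(\<Sum>i = min m m'..<max m m'. i) \<le> (\<Sum>i<b. i)"
    using m by (cases "m = m'") (auto intro!: sum_mono2)
  then have "max k k' * (\<Sum>i = min m m'..<max m m'. i) \<le> a * (\<Sum>i<b. i)"
    using k by (intro mult_le_mono) auto
  then have inner: "real (max k k' * (\<Sum>i = min m m'..<max m m'. i)) \<le> real (a * (\<Sum>i<b. i))"
    by (simp only: of_nat_le_iff)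
  have "(\<Sum>i = min k k'..<max k k'. i) \<le> (\<Sum>i<a. i)"
    using k by (intro sum_mono2) auto
  then have "real (\<Sum>i = min k k'..<max k k'. i) \<le> real (\<Sum>i<a. i)"
    by (simp only: of_nat_le_iff)
  moreover have "max (max u v) w \<le> max C (max C1 C2)" if "u \<le> C" "v \<le> C1" "w \<le> C2"
    for u v w C1 C2 :: real
    using that by auto
  ultimately show ?thesis
    unfolding d_2omega_eq using sup inner by blast
qed

section \<open>The upper bound\<close>

lemma pow2_multiples_near_imp_eq:
  assumes "u \<in> pow2_multiples k" "v \<in> pow2_multiples k" "\<bar>u - v\<bar> < 2 ^ k"
  shows "u = v"
proof -
  obtain a b :: int where ab: "u = 2 ^ k * of_int a" "v = 2 ^ k * of_int b"
    using assms(1,2) by (auto simp: pow2_multiples_def)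
  then have "\<bar>u - v\<bar> = 2 ^ k * \<bar>of_int a - of_int b\<bar>"
    by (simp add: abs_mult flip: right_diff_distrib)
  with assms(3) have "\<bar>real_of_int a - of_int b\<bar> < 1" by simp
  then have "a = b" by linarith
  with ab show ?thesis by simp
qed

text \<open>
  Within one piece of outer index \<open>k\<close> the points have coordinates in \<open>2\<^sup>k \<int>\<close>, and \<open>2\<^sup>k > k \<ge> a\<close>. Points
  of different pieces are at least \<open>a\<close> apart because of their indices.
\<close>
lemma discrete_at_outer_tail:
  fixes a :: nat
  shows "discrete_at d_2omega (real a) {p \<in> X_2omega. a \<le> fst p}" (is "discrete_at _ _ ?S")
proof (rule discrete_atI[where b = "\<lambda>p. p" and C = 0])
  fix p q assume pq: "p \<in> ?S" "q \<in> ?S"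
  obtain k m x where p: "p = (k, m, x)" by (cases p)
  obtain k' m' y where q: "q = (k', m', y)" by (cases q)
  have X: "(k, m, x) \<in> X_2omega" "(k', m', y) \<in> X_2omega" and a: "a \<le> k" "a \<le> k'"
    using pq by (auto simp: p q)
  have m: "m \<ge> 1" "m' \<ge> 1"
    using X by (auto simp: mem_X_2omega)
  { assume "p = q"
    then show "d_2omega p q \<le> 0"
      using m by (simp add: p q d_2omega_eq d_sup_def) }
  assume less: "d_2omega p q < real a"
  have "k = k'"
    using outer_index_le_d_2omega[of k k' m x m' y] less a by (fastforce simp: p q)
  have "m = m'"
  proof (rule ccontr)
    assume "m \<noteq> m'"
    have "a * 1 \<le> max k k' * min m m'"
      using a m by (intro mult_le_mono) auto
    then have "real a \<le> real (max k k' * min m m')"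
      by (simp only: of_nat_le_iff mult_1_right)
    with inner_index_le_d_2omega[OF \<open>m \<noteq> m'\<close>, of k k' x y] less show False
      by (simp add: p q)
  qed
  have "x l = y l" for l
  proof (cases "l \<in> {1..m}")
    case True
    have "\<bar>x l - y l\<bar> < real a"
      using coordinate_le_d_2omega[OF X, of l] less by (simp add: p q)
    also have "\<dots> \<le> real k" using a by simp
    also have "\<dots> < 2 ^ k" by (rule of_nat_less_two_power)
    finally show ?thesis
      using X True \<open>k = k'\<close> \<open>m = m'\<close>
      by (intro pow2_multiples_near_imp_eq) (auto simp: mem_X_2omega Y_piece_def)
  next
    case False
    then show ?thesis
      using X \<open>m = m'\<close> by (auto simp: mem_X_2omega Y_piece_def X_piece_def euclid_def)
  qed
  with \<open>k = k'\<close> \<open>m = m'\<close> show "p = q" by (auto simp: p q)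
qed

text \<open>
  Pieces of different inner index are \<open>i\<^sub>0\<close> apart, so the cells may be taken in each of them
  separately. Those of different outer index may be close to each other, but as the outer index is at
  most \<open>a\<close>, lumping them together adds only a constant to the diameters.
\<close>
lemma discrete_at_skeleton_layer:
  fixes a i\<^sub>0 t :: nat and s L :: real
  assumes "0 < s" "s \<le> real i\<^sub>0" "2 * (s + real t * s) + s \<le> L" "r \<le> s"
  shows "discrete_at d_2omega r
    {(k, m, x) \<in> X_2omega. k \<le> a \<and> i\<^sub>0 \<le> m \<and> x \<in> layer L s s {1..m} t}" (is "discrete_at _ _ ?S")
proof (rule discrete_atI[where
    b = "\<lambda>(k, m, x). (m, cell L (s + real t * s) {1..m} x)" and
    C = "max L (max (real (a * (\<Sum>i<0. i))) (real (\<Sum>i<a. i)))"])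
  let ?b = "\<lambda>(k, m, x). (m, cell L (s + real t * s) {1..m} x)"
  fix p q assume pq: "p \<in> ?S" "q \<in> ?S"
  obtain k m x where p: "p = (k, m, x)" by (cases p)
  obtain k' m' y where q: "q = (k', m', y)" by (cases q)
  have X: "(k, m, x) \<in> X_2omega" "(k', m', y) \<in> X_2omega"
    and m: "i\<^sub>0 \<le> m" "i\<^sub>0 \<le> m'" and k: "k \<le> a" "k' \<le> a" "1 \<le> k"
    and layers: "x \<in> layer L s s {1..m} t" "y \<in> layer L s s {1..m'} t"
    using pq by (auto simp: p q mem_X_2omega)
  have *: "2 * (s + u) \<le> L \<and> 0 < L" if "2 * (s + u) + s \<le> L" "0 \<le> u" for u
    using that \<open>0 < s\<close> by auto
  have L: "2 * (s + real t * s) \<le> L" "0 < L"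
    using *[OF assms(3)] \<open>0 < s\<close> by simp_all
  { assume less: "d_2omega p q < r"
    have "m = m'"
    proof (rule ccontr)
      assume "m \<noteq> m'"
      have "1 * i\<^sub>0 \<le> max k k' * min m m'"
        using k m by (intro mult_le_mono) auto
      then have "real i\<^sub>0 \<le> real (max k k' * min m m')"
        by (simp only: of_nat_le_iff mult_1_left)
      with inner_index_le_d_2omega[OF \<open>m \<noteq> m'\<close>, of k k' x y] less assms show False
        by (simp add: p q)
    qed
    moreover have "\<bar>x l - y l\<bar> < s" for l
      using coordinate_le_d_2omega[OF X, of l] less assms(4) by (simp add: p q)
    ultimately show "?b p = ?b q"
      using layers assms by (auto simp: p q intro!: layer_near) }
  assume "?b p = ?b q"
  then have eq: "m = m'" "cell L (s + real t * s) {1..m} x = cell L (s + real t * s) {1..m} y"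
    by (auto simp: p q)
  have "\<bar>x l - y l\<bar> \<le> L" if "l \<in> {1..max m m'}" for l
    using that cell_eq_imp_near[OF eq(2) L] eq(1) by simp
  from d_2omega_le[OF X this k(1,2), of 0] eq(1) show "d_2omega p q \<le> max L (max (real (a * (\<Sum>i<0. i))) (real (\<Sum>i<a. i)))"
    by (simp add: p q)
qed

text \<open>
  The counterpart for bounded inner index: now also the inner index can be ignored, and all points
  are treated as points of one space \<open>\<real>\<^sup>i\<close>.
\<close>
lemma discrete_at_small_layer:
  fixes a i\<^sub>0 t :: nat and s L :: real
  assumes "0 < s" "2 * (s + real t * s) + s \<le> L" "r \<le> s"
  shows "discrete_at d_2omega r
    {(k, m, x) \<in> X_2omega. k \<le> a \<and> m \<le> i\<^sub>0 \<and> x \<in> layer L s s {1..i\<^sub>0} t}" (is "discrete_at _ _ ?S")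
proof (rule discrete_atI[where
    b = "\<lambda>(k, m, x). cell L (s + real t * s) {1..i\<^sub>0} x" and
    C = "max L (max (real (a * (\<Sum>i<i\<^sub>0. i))) (real (\<Sum>i<a. i)))"])
  let ?b = "\<lambda>(k, m, x). cell L (s + real t * s) {1..i\<^sub>0} x"
  fix p q assume pq: "p \<in> ?S" "q \<in> ?S"
  obtain k m x where p: "p = (k, m, x)" by (cases p)
  obtain k' m' y where q: "q = (k', m', y)" by (cases q)
  have X: "(k, m, x) \<in> X_2omega" "(k', m', y) \<in> X_2omega"
    and m: "m \<le> i\<^sub>0" "m' \<le> i\<^sub>0" and k: "k \<le> a" "k' \<le> a"
    and layers: "x \<in> layer L s s {1..i\<^sub>0} t" "y \<in> layer L s s {1..i\<^sub>0} t"
    using pq by (auto simp: p q)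
  have *: "2 * (s + u) \<le> L \<and> 0 < L" if "2 * (s + u) + s \<le> L" "0 \<le> u" for u
    using that \<open>0 < s\<close> by auto
  have L: "2 * (s + real t * s) \<le> L" "0 < L"
    using *[OF assms(2)] \<open>0 < s\<close> by simp_all
  { assume less: "d_2omega p q < r"
    have "\<bar>x l - y l\<bar> < s" for l
      using coordinate_le_d_2omega[OF X, of l] less assms(3) by (simp add: p q)
    then show "?b p = ?b q"
      using layers assms by (auto simp: p q intro!: layer_near) }
  assume "?b p = ?b q"
  then have eq: "cell L (s + real t * s) {1..i\<^sub>0} x = cell L (s + real t * s) {1..i\<^sub>0} y"
    by (simp add: p q)
  have "\<bar>x l - y l\<bar> \<le> L" if "l \<in> {1..max m m'}" for l
    using that cell_eq_imp_near[OF eq L, of l] m by auto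
  from d_2omega_le[OF X this k, of i\<^sub>0] m show "d_2omega p q \<le> max L (max (real (a * (\<Sum>i<i\<^sub>0. i))) (real (\<Sum>i<a. i)))"
    by (simp add: p q)
qed

text \<open>
  A multiple of \<open>2\<^sup>m\<close> is a multiple of \<open>2\<^sup>p\<close>. So one mesh \<open>2\<^sup>p\<close> serves for all inner indices from
  \<open>p\<close> on.
\<close>
lemma far_X_piece:
  assumes "x \<in> X_piece k m" "p \<le> m" "r > 0"
  shows "card (far (2 ^ p) r {1..m} x) \<le> k"
proof -
  have "pow2_multiples m \<subseteq> range (\<lambda>z. 2 ^ p * real_of_int z)"
  proof
    fix u assume "u \<in> pow2_multiples m"
    then obtain z :: int where "u = 2 ^ m * of_int z"
      by (auto simp: pow2_multiples_def)
    then have "u = 2 ^ p * of_int (2 ^ (m - p) * z)"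
      using \<open>p \<le> m\<close> by (simp flip: power_add mult.assoc)
    then show "u \<in> range (\<lambda>z. 2 ^ p * real_of_int z)" by blast
  qed
  then have "far (2 ^ p) r {1..m} x \<subseteq> {l \<in> {1..m}. x l \<notin> pow2_multiples m}"
    using far_skeleton_subset[of "2 ^ p" r "{1..m}" x] \<open>r > 0\<close> by auto
  then have "card (far (2 ^ p) r {1..m} x) \<le> card {l \<in> {1..m}. x l \<notin> pow2_multiples m}"
    by (intro card_mono) auto
  then show ?thesis
    using assms(1) by (simp add: X_piece_def)
qed

lemma Fin_scale_bound:
  assumes "\<sigma> \<in> Fin {1..}"
  shows "0 < real (Max \<sigma>)" "i \<in> \<sigma> \<Longrightarrow> real i \<le> real (Max \<sigma>)"
proof -
  have \<sigma>: "finite \<sigma>" "\<sigma> \<noteq> {}" "\<sigma> \<subseteq> {1..}"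
    using assms by (auto simp: Fin_def)
  then have "Max \<sigma> \<in> {1..}" using Max_in by blast
  then show "0 < real (Max \<sigma>)" by simp
  show "real i \<le> real (Max \<sigma>)" if "i \<in> \<sigma>" using \<sigma> that by simp
qed

text \<open>
  The bound on the sizes is an inner index \<open>i\<^sub>0\<close> that depends on \<open>\<sigma>\<close> only: the scale \<open>a\<close> takes the
  outer tail, the scales in \<open>\<sigma>\<close> take one layer each of the pieces of inner index at least \<open>i\<^sub>0\<close>, and
  \<open>i\<^sub>0 + 1\<close> scales in \<open>\<tau>\<close> take the layers of the remaining points, in a space of dimension \<open>i\<^sub>0\<close>.
  There a point has at most \<open>i\<^sub>0\<close> far coordinates whatever the mesh, so that the mesh \<open>L\<close> can be
  adapted to \<open>\<tau>\<close>.
\<close>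
lemma X_2omega_links_bounded:
  assumes "a \<ge> 1" "\<sigma> \<subseteq> {1..}" "card \<sigma> = Suc a" "a \<notin> \<sigma>"
  shows "\<exists>n. \<forall>\<tau>\<in>link {1..} (A_family X_2omega d_2omega) (insert a \<sigma>). card \<tau> \<le> n"
proof -
  have \<sigma>: "\<sigma> \<in> Fin {1..}"
    using assms card.infinite by (fastforce simp: Fin_def)
  define s where "s = real (Max \<sigma>)"
  have s: "0 < s" "\<And>i. i \<in> \<sigma> \<Longrightarrow> real i \<le> s"
    using Fin_scale_bound[OF \<sigma>] by (simp_all add: s_def)
  obtain p where p: "2 * (s + real a * s) + s < 2 ^ p"
    using real_arch_pow[of 2 "2 * (s + real a * s) + s"] by auto
  define i\<^sub>0 where "i\<^sub>0 = max p (Max \<sigma>)"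
  have i\<^sub>0: "p \<le> i\<^sub>0" "s \<le> real i\<^sub>0"
    by (simp_all add: i\<^sub>0_def s_def)
  have "card \<tau> \<le> i\<^sub>0" if \<tau>: "\<tau> \<in> link {1..} (A_family X_2omega d_2omega) (insert a \<sigma>)" for \<tau>
  proof (rule ccontr)
    assume "\<not> card \<tau> \<le> i\<^sub>0"
    from \<tau> have Fin_\<tau>: "\<tau> \<in> Fin {1..}" and disj: "insert a \<sigma> \<inter> \<tau> = {}"
      and mem: "insert a \<sigma> \<union> \<tau> \<in> A_family X_2omega d_2omega"
      by (simp_all add: link_def)
    define s' where "s' = real (Max \<tau>)"
    have s': "0 < s'" "\<And>i. i \<in> \<tau> \<Longrightarrow> real i \<le> s'"
      using Fin_scale_bound[OF Fin_\<tau>] by (simp_all add: s'_def)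
    \<comment> \<open>The least mesh for which the last layer is admissible.\<close>
    define L where "L = 2 * (s' + real i\<^sub>0 * s') + s'"
    have "card {..a} = card \<sigma>" "finite \<sigma>"
      using assms(3) \<sigma> by (simp_all add: Fin_def)
    then obtain e where e: "bij_betw e {..a} \<sigma>"
      using finite_same_card_bij[of "{..a}" \<sigma>] by auto
    have "card {..i\<^sub>0} \<le> card \<tau>" "finite \<tau>"
      using \<open>\<not> card \<tau> \<le> i\<^sub>0\<close> Fin_\<tau> by (simp_all add: Fin_def)
    then obtain f where f: "inj_on f {..i\<^sub>0}" "f ` {..i\<^sub>0} \<subseteq> \<tau>"
      using card_le_inj[of "{..i\<^sub>0}" \<tau>] by auto
    define T where "T t = {(k, m, x) \<in> X_2omega. k \<le> a \<and> i\<^sub>0 \<le> m \<and> x \<in> layer (2 ^ p) s s {1..m} t}" for t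
    define U where "U t = {(k, m, x) \<in> X_2omega. k \<le> a \<and> m \<le> i\<^sub>0 \<and> x \<in> layer L s' s' {1..i\<^sub>0} t}" for t
    define S where "S i = (if i = a then {p \<in> X_2omega. a \<le> fst p}
      else if i \<in> \<sigma> then T (inv_into {..a} e i)
      else if i \<in> f ` {..i\<^sub>0} then U (inv_into {..i\<^sub>0} f i) else {})" for i
    have T: "discrete_at d_2omega (real i) (T t)" if "i \<in> \<sigma>" "t \<le> a" for i t
    proof -
      have "real t * s \<le> real a * s" using that s by (intro mult_right_mono) auto
      then have "2 * (s + real t * s) + s \<le> 2 * (s + real a * s) + s" by simp
      also note less_imp_le[OF p]
      finally have "2 * (s + real t * s) + s \<le> 2 ^ p" .
      with that show ?thesis
        unfolding T_def using s i\<^sub>0 by (intro discrete_at_skeleton_layer) auto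
    qed
    have U: "discrete_at d_2omega (real i) (U t)" if "i \<in> \<tau>" "t \<le> i\<^sub>0" for i t
    proof -
      have "real t * s' \<le> real i\<^sub>0 * s'" using that s' by (intro mult_right_mono) auto
      then have "2 * (s' + real t * s') + s' \<le> L" unfolding L_def by simp
      with that show ?thesis
        unfolding U_def using s' by (intro discrete_at_small_layer) auto
    qed
    have S: "S i \<subseteq> X_2omega \<and> discrete_at d_2omega (real i) (S i)" if i: "i \<in> insert a \<sigma> \<union> \<tau>" for i
    proof
      show "S i \<subseteq> X_2omega" by (auto simp: S_def T_def U_def)
      consider "i = a" | "i \<noteq> a" "i \<in> \<sigma>" | "i \<noteq> a" "i \<notin> \<sigma>" "i \<in> f ` {..i\<^sub>0}"
        | "i \<noteq> a" "i \<notin> \<sigma>" "i \<notin> f ` {..i\<^sub>0}" by blast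
      then show "discrete_at d_2omega (real i) (S i)"
      proof cases
        case 1
        then show ?thesis by (simp add: S_def discrete_at_outer_tail)
      next
        case 2
        then have "inv_into {..a} e i \<le> a"
          using e by (metis atMost_iff bij_betw_def inv_into_into)
        with 2 show ?thesis by (simp add: S_def T)
      next
        case 3
        then have "inv_into {..i\<^sub>0} f i \<le> i\<^sub>0" "i \<in> \<tau>"
          using inv_into_into[of i f "{..i\<^sub>0}"] f(2) by auto
        with 3 show ?thesis by (simp add: S_def U)
      next
        case 4
        then show ?thesis
          by (auto simp: S_def intro: discrete_atI[where b = "\<lambda>x. x" and C = 0])
      qed
    qed
    have "\<exists>i\<in>insert a \<sigma> \<union> \<tau>. q \<in> S i" if "q \<in> X_2omega" for q
    proof -
      obtain k m x where q: "q = (k, m, x)" by (cases q)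
      have x: "x \<in> X_piece k m"
        using that by (simp add: q mem_X_2omega Y_piece_def)
      consider "a \<le> k" | "k \<le> a" "i\<^sub>0 \<le> m" | "k \<le> a" "m \<le> i\<^sub>0" by linarith
      then show ?thesis
      proof cases
        case 1
        then show ?thesis using that by (intro bexI[of _ a]) (auto simp: S_def q)
      next
        case 2
        have "card (far (2 ^ p) s {1..m} x) \<le> a"
          using far_X_piece[OF x, of p s] 2 i\<^sub>0 s(1) by simp
        then obtain t where t: "t \<le> a" "x \<in> layer (2 ^ p) s s {1..m} t"
          using ex_layer[of "{1..m}" s "2 ^ p" s x a] s(1) by auto
        have "e t \<in> \<sigma>" "inv_into {..a} e (e t) = t"
          using e t(1) by (auto simp: bij_betw_def)
        with t 2 that \<open>a \<notin> \<sigma>\<close> show ?thesis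
          by (intro bexI[of _ "e t"]) (auto simp: S_def T_def q)
      next
        case 3
        have "card (far L s' {1..i\<^sub>0} x) \<le> card {1..i\<^sub>0}"
          by (intro card_mono) (auto simp: far_def)
        then obtain t where t: "t \<le> i\<^sub>0" "x \<in> layer L s' s' {1..i\<^sub>0} t"
          using ex_layer[of "{1..i\<^sub>0}" s' L s' x i\<^sub>0] s'(1) by auto
        have "f t \<in> \<tau>" "inv_into {..i\<^sub>0} f (f t) = t"
          using f t(1) by auto
        moreover have "f t \<noteq> a" "f t \<notin> \<sigma>"
          using \<open>f t \<in> \<tau>\<close> disj by auto
        ultimately show ?thesis
          using t 3 that by (intro bexI[of _ "f t"]) (auto simp: S_def U_def q)
      qed
    qed
    then have "X_2omega \<subseteq> (\<Union>i\<in>insert a \<sigma> \<union> \<tau>. S i)" by blast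
    moreover have "insert a \<sigma> \<union> \<tau> \<in> Fin {1..}"
      using \<sigma> Fin_\<tau> assms(1) by (auto simp: Fin_def)
    ultimately show False
      using mem A_family_iff S by blast
  qed
  then show ?thesis by blast
qed

section \<open>Lattice cubes and the lower bound for their dimension\<close>

definition cube_dist :: "nat \<Rightarrow> (nat \<Rightarrow> nat) \<Rightarrow> (nat \<Rightarrow> nat) \<Rightarrow> real" where
  "cube_dist N x y = (MAX l\<in>{..<N}. \<bar>real (x l) - real (y l)\<bar>)"

lemma cube_dist_iff:
  assumes "N > 0"
  shows "cube_dist N x y \<le> c \<longleftrightarrow> (\<forall>l<N. \<bar>real (x l) - real (y l)\<bar> \<le> c)"
    and "cube_dist N x y < c \<longleftrightarrow> (\<forall>l<N. \<bar>real (x l) - real (y l)\<bar> < c)"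
proof -
  have "finite ((\<lambda>l. \<bar>real (x l) - real (y l)\<bar>) ` {..<N})"
    "(\<lambda>l. \<bar>real (x l) - real (y l)\<bar>) ` {..<N} \<noteq> {}"
    using assms by auto
  then show "cube_dist N x y \<le> c \<longleftrightarrow> (\<forall>l<N. \<bar>real (x l) - real (y l)\<bar> \<le> c)"
    and "cube_dist N x y < c \<longleftrightarrow> (\<forall>l<N. \<bar>real (x l) - real (y l)\<bar> < c)"
    unfolding cube_dist_def by auto
qed

lemma cube_dist_refl: "N > 0 \<Longrightarrow> cube_dist N x x = 0"
  by (simp add: cube_dist_def image_constant_conv lessThan_empty_iff)

lemma cube_dist_sym: "cube_dist N x y = cube_dist N y x"
  by (simp add: cube_dist_def abs_minus_commute)

lemma cube_dist_coordinate: "l < N \<Longrightarrow> \<bar>real (x l) - real (y l)\<bar> \<le> cube_dist N x y"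
  unfolding cube_dist_def by (intro Max_ge) auto

lemma cube_dist_triangle:
  assumes "N > 0"
  shows "cube_dist N x z \<le> cube_dist N x y + cube_dist N y z"
  unfolding cube_dist_iff(1)[OF assms]
proof (intro allI impI)
  fix l assume "l < N"
  then show "\<bar>real (x l) - real (z l)\<bar> \<le> cube_dist N x y + cube_dist N y z"
    using cube_dist_coordinate[of l N x y] cube_dist_coordinate[of l N y z] by linarith
qed

text \<open>
  A lattice form of Lebesgue's covering theorem. Call a point of a large cube reached in direction
  \<open>j\<close> if it lies on the lower face or next to a block of \<open>S j\<close> that starts near this face. Since the
  blocks are bounded, points of the upper face are not reached, and Kuhn's lemma gives a unit cell that contains,
  for each \<open>j\<close>, both a reached and an unreached point. But for some \<open>j\<close> the corner of the cell
  lies in a block of \<open>S j\<close>. A point of the cell that is reached in direction \<open>j\<close> forces this block to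
  start near the lower face, whence all points of the cell are reached. The scale 3 leaves room for two unit steps.
\<close>
lemma lattice_not_covered_by_discrete_sets:
  assumes N: "N > 0" and discrete: "\<And>j. j < N \<Longrightarrow> discrete_at (cube_dist N) 3 (S j)"
    and cover: "\<And>q. \<exists>j<N. q \<in> S j"
  shows False
proof -
  let ?blocks = "\<lambda>j (b :: (nat \<Rightarrow> nat) \<Rightarrow> (nat \<Rightarrow> nat) set) C.
      (\<forall>x\<in>S j. \<forall>y\<in>S j. cube_dist N x y < 3 \<longrightarrow> b x = b y) \<and>
      (\<forall>x\<in>S j. \<forall>y\<in>S j. b x = b y \<longrightarrow> cube_dist N x y \<le> C)"
  have "\<forall>j\<in>{..<N}. \<exists>b C. ?blocks j b C"
  proof
    fix j assume "j \<in> {..<N}"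
    then have "discrete_at (cube_dist N) 3 (S j)"
      using discrete by simp
    then obtain b :: "(nat \<Rightarrow> nat) \<Rightarrow> (nat \<Rightarrow> nat) set" and C where
      "\<forall>x\<in>S j. \<forall>y\<in>S j. cube_dist N x y < 3 \<longrightarrow> b x = b y"
      "\<forall>x\<in>S j. \<forall>y\<in>S j. b x = b y \<longrightarrow> cube_dist N x y \<le> C"
      by (rule discrete_atE)
    then have "?blocks j b C" by (rule conjI)
    then show "\<exists>b C. ?blocks j b C" by (intro exI)
  qed
  then obtain b where "\<forall>j\<in>{..<N}. \<exists>C. ?blocks j (b j) C"
    by (rule bchoice[THEN exE])
  then obtain C where blocks: "\<forall>j\<in>{..<N}. ?blocks j (b j) (C j)"
    by (rule bchoice[THEN exE])
  have near: "b j x = b j y" if "j < N" "x \<in> S j" "y \<in> S j" "cube_dist N x y < 3" for j x y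
    using blocks that by simp
  have bounded: "cube_dist N x y \<le> C j" if "j < N" "x \<in> S j" "y \<in> S j" "b j x = b j y" for j x y
    using blocks that by simp
  \<comment> \<open>The cube is too large for a block to reach from one face to the opposite one.\<close>
  define p where "p = nat \<lceil>\<Sum>j<N. \<bar>C j\<bar>\<rceil> + 3"
  have p: "C j < real p - 2" if "j < N" for j
  proof -
    have "\<bar>C j\<bar> \<le> (\<Sum>j<N. \<bar>C j\<bar>)"
      using that by (intro member_le_sum) auto
    then show ?thesis unfolding p_def by linarith
  qed
  define starts where "starts j x \<longleftrightarrow> x j = 0 \<or>
      (\<exists>y\<in>S j. \<exists>z\<in>S j. cube_dist N x y \<le> 1 \<and> b j y = b j z \<and> z j \<le> 1)" for j x
  define label where "label x j = (if starts j x then 0 else 1 :: nat)" for x j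
  have at_end: "\<not> starts j x" if "j < N" "x j = p" for j x
  proof
    assume "starts j x"
    moreover have "x j \<noteq> 0" using that(2) by (simp add: p_def)
    ultimately obtain y z where "y \<in> S j" "z \<in> S j" "cube_dist N x y \<le> 1" "b j y = b j z" "z j \<le> 1"
      unfolding starts_def by blast
    then show False
      using bounded[OF \<open>j < N\<close>, of y z] p[OF \<open>j < N\<close>] that(2)
        cube_dist_coordinate[OF \<open>j < N\<close>, of x y] cube_dist_coordinate[OF \<open>j < N\<close>, of y z]
      by linarith
  qed
  have "0 < p" by (simp add: p_def)
  then obtain q where q: "\<And>j. j < N \<Longrightarrow> \<exists>r s. (\<forall>l<N. q l \<le> r l \<and> r l \<le> q l + 1) \<and>
      (\<forall>l<N. q l \<le> s l \<and> s l \<le> q l + 1) \<and> label r j \<noteq> label s j"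
    by (rule kuhn_lemma[of p N label]) (use at_end in \<open>auto simp: label_def starts_def\<close>)
  obtain j where j: "j < N" "q \<in> S j"
    using cover by blast
  have "starts j s" if r: "\<forall>l<N. q l \<le> r l \<and> r l \<le> q l + 1" "starts j r"
    and s: "\<forall>l<N. q l \<le> s l \<and> s l \<le> q l + 1" for r s
  proof -
    have qr: "cube_dist N q r \<le> 1" and sq: "cube_dist N s q \<le> 1"
      unfolding cube_dist_iff[OF N] using r(1) s by (auto simp: abs_le_iff)
    have "\<exists>z\<in>S j. b j q = b j z \<and> z j \<le> 1"
    proof (cases "r j = 0")
      case True
      then have "q j = 0" using r(1) j(1) by (metis le_zero_eq)
      with j show ?thesis by (intro bexI[of _ q]) auto
    next
      case False
      with r(2) obtain y z where yz: "y \<in> S j" "z \<in> S j" "cube_dist N r y \<le> 1" "b j y = b j z" "z j \<le> 1"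
        unfolding starts_def by blast
      have "cube_dist N q y < 3"
        using cube_dist_triangle[OF N, of q y r] qr yz(3) by linarith
      with near[OF j(1,2)] yz show ?thesis by metis
    qed
    with j sq show ?thesis
      unfolding starts_def by blast
  qed
  with q[OF j(1)] show False
    unfolding label_def by (metis (full_types))
qed

section \<open>The lower bound\<close>

text \<open>
  On each period of length \<open>h + 2 * A\<close> the function rests for \<open>A\<close> steps, grows from one multiple of
  \<open>h\<close> to the next one during \<open>h\<close> steps, and rests again. If all but \<open>K\<close> coordinates of a lattice
  point are at rest, then applying it to each coordinate leads to the \<open>K\<close>-skeleton of the grid of
  mesh \<open>h\<close>. A retraction onto the skeleton would have to stretch cells and so enlarge distances. The
  rests make the cells of the domain larger than those of the image, and no distance increases.
\<close>
definition stretch :: "nat \<Rightarrow> nat \<Rightarrow> nat \<Rightarrow> nat" where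
  "stretch A h y = h * (y div (h + 2 * A)) + min h (y mod (h + 2 * A) - A)"

lemma stretch_Suc:
  assumes "A > 0"
  shows "stretch A h y \<le> stretch A h (Suc y) \<and> stretch A h (Suc y) \<le> Suc (stretch A h y)"
proof (cases "Suc (y mod (h + 2 * A)) = h + 2 * A")
  case True
  then have "Suc y mod (h + 2 * A) = 0" "Suc y div (h + 2 * A) = Suc (y div (h + 2 * A))"
    by (simp_all add: mod_Suc div_Suc)
  moreover have "min h (y mod (h + 2 * A) - A) = h"
    using True assms by simp
  ultimately show ?thesis
    by (simp add: stretch_def)
next
  case False
  then have "Suc y mod (h + 2 * A) = Suc (y mod (h + 2 * A))"
    "Suc y div (h + 2 * A) = y div (h + 2 * A)"
    by (simp_all add: mod_Suc div_Suc)
  then show ?thesis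
    by (auto simp: stretch_def min_def)
qed

lemma stretch_lipschitz:
  assumes "A > 0"
  shows "\<bar>real (stretch A h x) - real (stretch A h y)\<bar> \<le> \<bar>real x - real y\<bar>"
proof -
  have *: "stretch A h x \<le> stretch A h y \<and> stretch A h y + x \<le> stretch A h x + y" if "x \<le> y" for x y
    using that
  proof (induction y rule: dec_induct)
    case base
    then show ?case by simp
  next
    case (step y)
    then show ?case using stretch_Suc[OF assms, of h y] by linarith
  qed
  then show ?thesis
    using *[of x y] *[of y x] by (cases "x \<le> y") linarith+
qed

lemma stretch_proper:
  assumes "h > 0" "stretch A h x \<le> stretch A h y + c"
  shows "x \<le> y + (h + 2 * A) * (c + 2)"
proof -
  define P where "P = h + 2 * A"
  have P: "0 < P" using assms(1) by (simp add: P_def)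
  have "h * (x div P) \<le> stretch A h x" "stretch A h y \<le> h * (y div P) + h"
    by (simp_all add: stretch_def P_def)
  moreover have "c \<le> h * c" using assms(1) by simp
  ultimately have "h * (x div P) \<le> h * (y div P) + h + h * c"
    using assms(2) by linarith
  then have "h * (x div P) \<le> h * (y div P + 1 + c)"
    by (simp add: algebra_simps)
  then have "x div P \<le> y div P + 1 + c"
    using assms(1) by (simp only: nat_mult_le_cancel1)
  then have "P * (x div P) \<le> P * (y div P + 1 + c)"
    by (rule mult_le_mono2)
  moreover have "P * (y div P + 1 + c) = P * (y div P) + P + P * c"
    by (simp add: algebra_simps)
  ultimately have "x \<le> y + P * c + P + P"
    using dividend_less_times_div[OF P, of x] times_div_less_eq_dividend[of P y] by linarith
  then show ?thesis by (simp add: P_def algebra_simps)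
qed

text \<open>
  The growing phases are the intervals of radius \<open>h / 2\<close> about the points \<open>A + h / 2\<close>, modulo the
  period. Outside their interiors the value rests at a multiple of \<open>h\<close>.
\<close>
lemma dvd_stretch:
  assumes "h > 0"
    and far: "real h / 2 \<le> grid_dist (real (h + 2 * A)) (real y - (real A + real h / 2))"
  shows "h dvd stretch A h y"
proof -
  define P where "P = h + 2 * A"
  define m where "m = y div P"
  define r where "r = y mod P"
  have "real y = real (P * m + r)"
    by (simp add: m_def r_def)
  then have y: "real y = real P * real m + real r"
    by simp
  have "grid_dist (real P) (real y - (real A + real h / 2))
      \<le> \<bar>real y - (real A + real h / 2) - real P * of_int (int m)\<bar>"
    using assms(1) by (intro grid_dist_le) (simp add: P_def)
  also have "\<dots> = \<bar>real r - (real A + real h / 2)\<bar>"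
    unfolding y by (simp add: algebra_simps)
  finally have "real h / 2 \<le> \<bar>real r - (real A + real h / 2)\<bar>"
    using far unfolding P_def by (rule order_trans[rotated])
  then have "real r \<le> real A \<or> real A + real h \<le> real r"
    by linarith
  then have "r \<le> A \<or> A + h \<le> r"
    by linarith
  then have "min h (r - A) = 0 \<or> min h (r - A) = h"
    by linarith
  then show ?thesis
    by (auto simp: stretch_def P_def r_def)
qed

text \<open>
  \<open>K\<close> is the outer and \<open>N\<close> the inner index. Lattice coordinates are counted from 0, those of the
  space from 1.
\<close>
definition skeleton_point :: "nat \<Rightarrow> nat \<Rightarrow> nat \<Rightarrow> nat \<Rightarrow> (nat \<Rightarrow> nat) \<Rightarrow> nat \<times> nat \<times> (nat \<Rightarrow> real)" where
  "skeleton_point A h K N q =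
    (K, N, \<lambda>l. if l \<in> {1..N} then 2 ^ K * real (stretch A h (q (l - 1))) else 0)"

text \<open>
  Here \<open>h = 2 ^ n\<close>, so a value that \<open>h\<close> divides becomes a multiple of \<open>2 ^ (n + K)\<close> after
  scaling by \<open>2 ^ K\<close>, which is a point of the grid for the inner index \<open>n + K\<close>.
\<close>
lemma skeleton_point_mem:
  assumes "K > 0" "card {l \<in> {..<n + K}. \<not> 2 ^ n dvd stretch A (2 ^ n) (q l)} \<le> K"
  shows "skeleton_point A (2 ^ n) K (n + K) q \<in> X_2omega"
proof -
  let ?x = "\<lambda>l. if l \<in> {1..n + K} then 2 ^ K * real (stretch A (2 ^ n) (q (l - 1))) else 0"
  let ?B = "{l \<in> {..<n + K}. \<not> 2 ^ n dvd stretch A (2 ^ n) (q l)}"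
  have "{l \<in> {1..n + K}. ?x l \<notin> pow2_multiples (n + K)} \<subseteq> Suc ` ?B"
  proof
    fix l assume l: "l \<in> {l \<in> {1..n + K}. ?x l \<notin> pow2_multiples (n + K)}"
    have "\<not> 2 ^ n dvd stretch A (2 ^ n) (q (l - 1))"
    proof
      assume "2 ^ n dvd stretch A (2 ^ n) (q (l - 1))"
      then obtain z where "stretch A (2 ^ n) (q (l - 1)) = 2 ^ n * z" by (elim dvdE)
      then have "?x l = 2 ^ (n + K) * real_of_int (int z)"
        using l by (simp add: power_add)
      then have "?x l \<in> pow2_multiples (n + K)"
        unfolding pow2_multiples_def by blast
      with l show False by blast
    qed
    with l have "l - 1 \<in> ?B" "l = Suc (l - 1)" by auto
    then show "l \<in> Suc ` ?B" by blast
  qed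
  then have "card {l \<in> {1..n + K}. ?x l \<notin> pow2_multiples (n + K)} \<le> card (Suc ` ?B)"
    by (intro card_mono) auto
  also have "\<dots> \<le> K"
    using assms(2) by (simp add: card_image)
  finally have "?x \<in> X_piece K (n + K)"
    unfolding X_piece_def euclid_def by auto
  moreover have "?x l \<in> pow2_multiples K" for l
  proof (cases "l \<in> {1..n + K}")
    case True
    then have "?x l = 2 ^ K * real_of_int (int (stretch A (2 ^ n) (q (l - 1))))" by simp
    then show ?thesis unfolding pow2_multiples_def by blast
  next
    case False
    then have "?x l = 2 ^ K * real_of_int 0" by auto
    then show ?thesis unfolding pow2_multiples_def by blast
  qed
  ultimately have "?x \<in> Y_piece K (n + K)"
    unfolding Y_piece_def by blast
  then show ?thesis
    using \<open>K > 0\<close> by (simp add: skeleton_point_def mem_X_2omega)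
qed

lemma d_2omega_skeleton_point_le:
  assumes "A > 0" "N > 0"
  shows "d_2omega (skeleton_point A h K N q) (skeleton_point A h K N q') \<le> 2 ^ K * cube_dist N q q'"
proof -
  let ?x = "\<lambda>q l. if l \<in> {1..N} then 2 ^ K * real (stretch A h (q (l - 1))) else 0"
  have "\<bar>?x q l - ?x q' l\<bar> \<le> 2 ^ K * cube_dist N q q'" if "l \<in> {1..N}" for l
  proof -
    have "\<bar>?x q l - ?x q' l\<bar> = 2 ^ K * \<bar>real (stretch A h (q (l - 1))) - real (stretch A h (q' (l - 1)))\<bar>"
      using that by (simp add: abs_mult flip: right_diff_distrib)
    also have "\<dots> \<le> 2 ^ K * cube_dist N q q'"
    proof (rule mult_left_mono)
      have "l - 1 < N" using that by auto
      from cube_dist_coordinate[OF this, of q q']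
      show "\<bar>real (stretch A h (q (l - 1))) - real (stretch A h (q' (l - 1)))\<bar> \<le> cube_dist N q q'"
        using stretch_lipschitz[OF assms(1), of h "q (l - 1)" "q' (l - 1)"] by linarith
    qed simp
    finally show ?thesis .
  qed
  then have "d_sup N (?x q) (?x q') \<le> 2 ^ K * cube_dist N q q'"
    unfolding d_sup_def using assms(2) by (intro Max.boundedI) auto
  moreover have "0 \<le> cube_dist N q q'"
    using cube_dist_coordinate[OF assms(2), of q q'] by linarith
  ultimately show ?thesis
    unfolding skeleton_point_def d_2omega_eq by simp
qed

lemma skeleton_point_proper:
  fixes A h :: nat
  assumes "h > 0" "N > 0" and X: "skeleton_point A h K N q \<in> X_2omega" "skeleton_point A h K N q' \<in> X_2omega"
    and le: "d_2omega (skeleton_point A h K N q) (skeleton_point A h K N q') \<le> C"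
  shows "cube_dist N q q' \<le> real ((h + 2 * A) * (nat \<lceil>C\<rceil> + 2))"
  unfolding cube_dist_iff(1)[OF assms(2)]
proof (intro allI impI)
  fix l assume l: "l < N"
  let ?s = "\<lambda>q. stretch A h (q l)"
  have "\<bar>2 ^ K * real (?s q) - 2 ^ K * real (?s q')\<bar> \<le> C"
    using coordinate_le_d_2omega[OF X[unfolded skeleton_point_def], of "Suc l"] le l
    by (simp add: skeleton_point_def)
  then have "2 ^ K * \<bar>real (?s q) - real (?s q')\<bar> \<le> C"
    by (simp add: abs_mult flip: right_diff_distrib)
  moreover have "\<bar>real (?s q) - real (?s q')\<bar> \<le> 2 ^ K * \<bar>real (?s q) - real (?s q')\<bar>"
    by (simp add: mult_le_cancel_right1)
  ultimately have "\<bar>real (?s q) - real (?s q')\<bar> \<le> C" by (rule order_trans[rotated])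
  then have "?s q \<le> ?s q' + nat \<lceil>C\<rceil>" "?s q' \<le> ?s q + nat \<lceil>C\<rceil>" by linarith+
  from this[THEN stretch_proper[OF assms(1)]]
  have "q l \<le> q' l + (h + 2 * A) * (nat \<lceil>C\<rceil> + 2)" "q' l \<le> q l + (h + 2 * A) * (nat \<lceil>C\<rceil> + 2)" .
  then have "real (q l) \<le> real (q' l + (h + 2 * A) * (nat \<lceil>C\<rceil> + 2))"
    "real (q' l) \<le> real (q l + (h + 2 * A) * (nat \<lceil>C\<rceil> + 2))"
    by (simp_all only: of_nat_le_iff)
  then show "\<bar>real (q l) - real (q' l)\<bar> \<le> real ((h + 2 * A) * (nat \<lceil>C\<rceil> + 2))"
    unfolding of_nat_add by linarith
qed

lemma discrete_at_skeleton_preimage: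
  assumes "A > 0" "h > 0" "N > 0" "S \<subseteq> X_2omega" "discrete_at d_2omega R S" "2 ^ K * r \<le> R"
  shows "discrete_at (cube_dist N) r {q. skeleton_point A h K N q \<in> S}"
proof (rule discrete_at_vimage[OF assms(5), where f = "skeleton_point A h K N"])
  fix q q' assume "cube_dist N q q' < r"
  then have "2 ^ K * cube_dist N q q' < 2 ^ K * r" by simp
  with d_2omega_skeleton_point_le[OF assms(1,3), of h K q q'] assms(6)
  show "d_2omega (skeleton_point A h K N q) (skeleton_point A h K N q') < R" by linarith
next
  fix C
  show "\<exists>C'. \<forall>q\<in>{q. skeleton_point A h K N q \<in> S}. \<forall>q'\<in>{q. skeleton_point A h K N q \<in> S}.
      d_2omega (skeleton_point A h K N q) (skeleton_point A h K N q') \<le> C \<longrightarrow> cube_dist N q q' \<le> C'"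
    using skeleton_point_proper[OF assms(2,3)] assms(4) by blast
qed simp

text \<open>
  With this shift, the multiples of the period \<open>h + 2 * A\<close> correspond to the centres of the growing
  phases, so that the dual skeleton becomes the skeleton of a grid that starts at 0.
\<close>
definition centred :: "nat \<Rightarrow> nat \<Rightarrow> (nat \<Rightarrow> nat) \<Rightarrow> nat \<Rightarrow> real" where
  "centred A h q = (\<lambda>l. real (q l) - (real A + real h / 2))"

text \<open>
  Directions \<open>j < n\<close> of the lattice belong to the scales in \<open>\<tau>\<close>, the others to those in \<open>\<sigma>\<close>. A hole,
  that is a lattice point without image in the space, has more than \<open>K\<close> growing coordinates, hence
  fewer than \<open>n\<close> coordinates far from the centres, so that \<open>n\<close> layers suffice for the holes.
\<close>
lemma X_2omega_links_unbounded:
  assumes K: "K > 0"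
  shows "\<exists>\<sigma>\<subseteq>{1..}. card \<sigma> = K \<and>
    (\<forall>n. \<exists>\<tau>\<in>link {1..} (A_family X_2omega d_2omega) \<sigma>. card \<tau> > n)"
proof -
  \<comment> \<open>Lattice points at distance less than 3 have images at distance less than \<open>3 * 2 ^ K\<close>.\<close>
  define s\<^sub>0 :: nat where "s\<^sub>0 = 3 * 2 ^ K"
  define \<sigma> where "\<sigma> = {s\<^sub>0..<s\<^sub>0 + K}"
  have s\<^sub>0: "s\<^sub>0 > 0" by (simp add: s\<^sub>0_def)
  have "\<exists>\<tau>\<in>link {1..} (A_family X_2omega d_2omega) \<sigma>. card \<tau> > n\<^sub>0" for n\<^sub>0
  proof -
    define n where "n = n\<^sub>0 + 2"
    define h :: nat where "h = 2 ^ n"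
    \<comment> \<open>The resting phases leave room for \<open>n\<close> layers of width 3.\<close>
    define A where "A = 3 * n"
    define P where "P = h + 2 * A"
    define N where "N = n + K"
    \<comment> \<open>The scales in \<open>\<tau>\<close> have to absorb blocks of diameter \<open>P\<close> with a margin of 3 on both sides.\<close>
    define R where "R = 2 ^ K * (6 + P) + s\<^sub>0 + K"
    define \<tau> where "\<tau> = {R..<R + n}"
    have pos: "n > 0" "A > 0" "h > 0" "N > 0" "P > 0"
      by (simp_all add: n_def A_def h_def N_def P_def)
    \<comment> \<open>The innermost layer needs \<open>h \<ge> 3\<close>, which is why \<open>n\<close> is at least 2.\<close>
    have "2 ^ 2 \<le> h" unfolding h_def by (intro power_increasing) (simp_all add: n_def)
    then have h: "3 \<le> real h" by simp
    have Fin: "\<tau> \<in> Fin {1..}" "\<sigma> \<union> \<tau> \<in> Fin {1..}"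
      using s\<^sub>0 pos K by (auto simp: Fin_def \<sigma>_def \<tau>_def R_def)
    have "\<sigma> \<union> \<tau> \<in> A_family X_2omega d_2omega"
      unfolding A_family_iff[OF Fin(2)]
    proof
      assume "\<exists>S. (\<forall>i\<in>\<sigma> \<union> \<tau>. S i \<subseteq> X_2omega \<and> discrete_at d_2omega (real i) (S i)) \<and>
        X_2omega \<subseteq> (\<Union>i\<in>\<sigma> \<union> \<tau>. S i)"
      then obtain S where S: "\<And>i. i \<in> \<sigma> \<union> \<tau> \<Longrightarrow> S i \<subseteq> X_2omega"
        "\<And>i. i \<in> \<sigma> \<union> \<tau> \<Longrightarrow> discrete_at d_2omega (real i) (S i)"
        and cover: "X_2omega \<subseteq> (\<Union>i\<in>\<sigma> \<union> \<tau>. S i)" by auto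
      define g where "g = skeleton_point A h K N"
      define Q where "Q i = {q. g q \<in> S i}" for i
      define U where "U j = {q. g q \<notin> X_2omega \<and> centred A h q \<in> layer (real P) (real h / 2) 3 {..<N} j}" for j
      define T where "T j = (if j < n then Q (R + j) \<union> U j else Q (s\<^sub>0 + (j - n)))" for j
      have Q: "discrete_at (cube_dist N) r (Q i)" if "i \<in> \<sigma> \<union> \<tau>" "2 ^ K * r \<le> real i" for i r
        unfolding Q_def g_def using that S pos by (intro discrete_at_skeleton_preimage) auto
      have far_hole: "card (far (real P) (real h / 2) {..<N} (centred A h q)) \<le> n - 1"
        if "g q \<notin> X_2omega" for q
      proof -
        let ?F = "far (real P) (real h / 2) {..<N} (centred A h q)"
        let ?B = "{l \<in> {..<N}. \<not> h dvd stretch A h (q l)}"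
        have "\<not> card ?B \<le> K"
          using that skeleton_point_mem[OF K, of n A q] unfolding g_def h_def N_def by blast
        moreover have "?F \<inter> ?B = {}"
          using dvd_stretch[OF pos(3), of A] by (auto simp: far_def centred_def P_def)
        then have "card ?F + card ?B = card (?F \<union> ?B)"
          by (intro card_Un_disjoint[symmetric]) (auto simp: far_def)
        moreover have "card (?F \<union> ?B) \<le> card {..<N}"
          by (intro card_mono) (auto simp: far_def)
        ultimately show ?thesis by (simp add: N_def)
      qed
      have T: "discrete_at (cube_dist N) 3 (T j)" if j: "j < N" for j
      proof (cases "j < n")
        case True
        have "real (2 ^ K * (6 + P)) \<le> real (R + j)"
          unfolding of_nat_le_iff by (simp add: R_def)
        then have "2 ^ K * (2 * 3 + real P) \<le> real (R + j)" by simp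
        then have QR: "discrete_at (cube_dist N) (2 * 3 + real P) (Q (R + j))"
          using True by (intro Q) (auto simp: \<tau>_def)
        let ?r = "real h / 2 + real j * 3"
        have scale: "2 * ?r + 3 \<le> real P" "2 * ?r \<le> real P"
          using True by (simp_all add: P_def A_def)
        have "discrete_at (cube_dist N) 3 (Q (R + j) \<union> U j)"
        proof (rule discrete_at_saturated_union[OF cube_dist_sym cube_dist_triangle[OF pos(4)]
              cube_dist_refl[OF pos(4)] QR,
              where c = "\<lambda>q. cell (real P) ?r {..<N} (centred A h q)"])
          have "Q (R + j) \<subseteq> {q. g q \<in> X_2omega}"
            using S(1)[of "R + j"] True by (auto simp: Q_def \<tau>_def)
          then show "Q (R + j) \<inter> U j = {}" by (auto simp: U_def)
        next
          fix x y assume xy: "x \<in> U j" "y \<in> U j" "cube_dist N x y < 3"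
          then have "\<bar>centred A h x l - centred A h y l\<bar> < 3" if "l \<in> {..<N}" for l
            using that cube_dist_iff(2)[OF pos(4)] by (simp add: centred_def)
          then show "cell (real P) ?r {..<N} (centred A h x) = cell (real P) ?r {..<N} (centred A h y)"
            using xy h scale by (intro layer_near) (auto simp: U_def)
        next
          fix x y assume "cell (real P) ?r {..<N} (centred A h x) = cell (real P) ?r {..<N} (centred A h y)"
          from cell_eq_imp_near[OF this scale(2)] pos(5)
          have "\<bar>real (x l) - real (y l)\<bar> \<le> real P" if "l < N" for l
            using that by (simp add: centred_def)
          then show "cube_dist N x y \<le> real P"
            using cube_dist_iff(1)[OF pos(4)] by blast
        qed simp_all
        with True show ?thesis by (simp add: T_def)
      next
        case False
        have "real (2 ^ K * 3) \<le> real (s\<^sub>0 + (j - n))"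
          unfolding of_nat_le_iff by (simp add: s\<^sub>0_def)
        then have "2 ^ K * 3 \<le> real (s\<^sub>0 + (j - n))" by simp
        then have "discrete_at (cube_dist N) 3 (Q (s\<^sub>0 + (j - n)))"
          using False j by (intro Q) (auto simp: \<sigma>_def N_def)
        with False show ?thesis by (simp add: T_def)
      qed
      have "\<exists>j<N. q \<in> T j" for q
      proof (cases "g q \<in> X_2omega")
        case True
        with cover obtain i where i: "i \<in> \<sigma> \<union> \<tau>" "q \<in> Q i"
          by (auto simp: Q_def)
        show ?thesis
        proof (cases "i \<in> \<sigma>")
          case True
          with i show ?thesis
            by (intro exI[of _ "n + (i - s\<^sub>0)"]) (auto simp: T_def \<sigma>_def N_def)
        next
          case False
          with i have "i \<in> \<tau>" by blast
          with i show ?thesis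
            by (intro exI[of _ "i - R"]) (auto simp: T_def \<tau>_def N_def)
        qed
      next
        case False
        obtain j where "j \<le> n - 1" "centred A h q \<in> layer (real P) (real h / 2) 3 {..<N} j"
          using ex_layer[of "{..<N}" 3, OF _ _ far_hole[OF False]] by auto
        with False pos show ?thesis
          by (intro exI[of _ j]) (auto simp: T_def U_def N_def)
      qed
      from lattice_not_covered_by_discrete_sets[OF pos(4) T this] show False .
    qed
    moreover have "\<sigma> \<inter> \<tau> = {}" by (auto simp: \<sigma>_def \<tau>_def R_def)
    ultimately have "\<tau> \<in> link {1..} (A_family X_2omega d_2omega) \<sigma>"
      using Fin by (simp add: link_def)
    moreover have "card \<tau> > n\<^sub>0" by (simp add: \<tau>_def n_def)
    ultimately show ?thesis by blast
  qed
  moreover have "\<sigma> \<subseteq> {1..}" "card \<sigma> = K"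
    using s\<^sub>0 by (auto simp: \<sigma>_def)
  ultimately show ?thesis by blast
qed

theorem theorem1:
  shows "trasdim X_2omega d_2omega = Ordinal two_omega"
  unfolding trasdim_def
proof (rule Ord_eq_two_omegaI)
  show "A_family X_2omega d_2omega \<subseteq> Fin {1..}"
    by (auto simp: A_family_def)
  show "\<exists>k>0. \<forall>\<sigma>\<subseteq>{1..}. card \<sigma> = k \<longrightarrow> a \<notin> \<sigma> \<longrightarrow>
      (\<exists>n. \<forall>\<tau>\<in>link {1..} (A_family X_2omega d_2omega) (insert a \<sigma>). card \<tau> \<le> n)"
    if "a \<in> {1..}" for a
    using X_2omega_links_bounded[of a] that by (intro exI[of _ "Suc a"]) simp
  show "\<exists>\<sigma>\<subseteq>{1..}. card \<sigma> = k \<and> (\<forall>n. \<exists>\<tau>\<in>link {1..} (A_family X_2omega d_2omega) \<sigma>. n < card \<tau>)"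
    if "k > 0" for k
    using X_2omega_links_unbounded[OF that] .
qed

end
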